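(* Let $n\ge1$. There exist vectors $V_1,V_2\in\mathbb{R}^{\Delta_n}$ such that $$V_1+\mathrm{HIVE}_n\ \supseteq\ \log\mathcal{H}_n\ \supseteq\ V_2+\mathrm{HIVE}_n .$$
   Context: $\Delta_n$ is the set of triples $(i,j,k)$ of nonnegative integers with $i+j+k=n$. $\mathrm{HIVE}_n\subset\mathbb{R}^{\Delta_n}$ is the cone of hives, i.e. of functions $h:\Delta_n\to\mathbb{R}$ with $$h_{(i+1)j(k-1)}+h_{i(j+1)(k-1)}\ge h_{ijk}+h_{(i+1)(j+1)(k-2)},$$ $$h_{(i+1)(j-1)k}+h_{i(j-1)(k+1)}\ge h_{ijk}+h_{(i+1)(j-2)(k+1)},$$ $$h_{(i-1)(j+1)k}+h_{(i-1)j(k+1)}\ge h_{ijk}+h_{(i-2)(j+1)(k+1)}$$ whenever all the indices occurring lie in $\Delta_n$. $\mathcal{H}_n\subset\mathbb{R}[x,y,z]$ is the set of homogeneous degree $n$ polynomials of the form $\det(xX+yY+zZ)$ with $X,Y,Z$ positive definite Hermitian complex $n\times n$ matrices. All coefficients $F_{ijk}$, $(i,j,k)\in\Delta_n$, of such a polynomial $F=\sum F_{ijk}x^iy^jz^k$ are positive, and $\log\mathcal{H}_n\subset\mathbb{R}^{\Delta_n}$ is the set of vectors $(\log F_{ijk})_{(i,j,k)\in\Delta_n}$ with $F\in\mathcal{H}_n$. *)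

theory Defs
  imports Complex_Main
    "HOL-Library.Poly_Mapping"
    "HOL-Library.Product_Plus"
    "Jordan_Normal_Form.Schur_Decomposition"
begin

type_synonym triple = "nat \<times> nat \<times> nat"

definition Delta :: "nat \<Rightarrow> triple set" where
  "Delta n = {(i, j, k). i + j + k = n}"

text \<open>
  The space \<open>\<real>\<^bsup>\<Delta>\<^esup>\<close> with \<open>\<Delta> = Delta n\<close> is represented by the real functions on all triples
  that vanish outside \<open>Delta n\<close>.
\<close>

definition RDelta :: "nat \<Rightarrow> (triple \<Rightarrow> real) set" where
  "RDelta n = {h. \<forall>d. d \<notin> Delta n \<longrightarrow> h d = 0}"

definition translate :: "(triple \<Rightarrow> real) \<Rightarrow> (triple \<Rightarrow> real) set \<Rightarrow> (triple \<Rightarrow> real) set" where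
  "translate V S = (\<lambda>h d. V d + h d) ` S"

text \<open>
  For \<open>(i, j, k) \<in> Delta n\<close>, the four indices of the first rhombus inequality all lie in \<open>Delta n\<close>
  exactly when \<open>2 \<le> k\<close>; likewise for the others with \<open>2 \<le> j\<close> and \<open>2 \<le> i\<close>. Under these guards no
  subtraction on naturals is truncated.
\<close>

definition HIVE :: "nat \<Rightarrow> (triple \<Rightarrow> real) set" where
  "HIVE n = {h \<in> RDelta n. \<forall>i j k. (i, j, k) \<in> Delta n \<longrightarrow>
     (2 \<le> k \<longrightarrow>
        h (i + 1, j, k - 1) + h (i, j + 1, k - 1) \<ge> h (i, j, k) + h (i + 1, j + 1, k - 2)) \<and>
     (2 \<le> j \<longrightarrow>
        h (i + 1, j - 1, k) + h (i, j - 1, k + 1) \<ge> h (i, j, k) + h (i + 1, j - 2, k + 1)) \<and>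
     (2 \<le> i \<longrightarrow>
        h (i - 1, j + 1, k) + h (i - 1, j, k + 1) \<ge> h (i, j, k) + h (i - 2, j + 1, k + 1))}"

text \<open>
  The polynomial ring \<open>R[x, y, z]\<close> is the monoid algebra of \<open>\<nat>\<^sup>3\<close> over \<open>R\<close>: the triple
  \<open>(i, j, k)\<close> stands for the monomial \<open>x\<^sup>i y\<^sup>j z\<^sup>k\<close>, and \<open>lookup F (i, j, k)\<close> is its coefficient.
  Addition of triples is componentwise, so the product of \<open>Poly_Mapping\<close> is the usual one.
\<close>

type_synonym 'a poly3 = "triple \<Rightarrow>\<^sub>0 'a"

definition const3 :: "'a \<Rightarrow> 'a::comm_ring_1 poly3" where
  "const3 c = Poly_Mapping.single (0, 0, 0) c"

definition var_x :: "'a::comm_ring_1 poly3" where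
  "var_x = Poly_Mapping.single (1, 0, 0) 1"

definition var_y :: "'a::comm_ring_1 poly3" where
  "var_y = Poly_Mapping.single (0, 1, 0) 1"

definition var_z :: "'a::comm_ring_1 poly3" where
  "var_z = Poly_Mapping.single (0, 0, 1) 1"

definition homogeneous3 :: "nat \<Rightarrow> 'a::zero poly3 \<Rightarrow> bool" where
  "homogeneous3 n F \<longleftrightarrow> Poly_Mapping.keys F \<subseteq> Delta n"

definition pos_def_hermitian :: "nat \<Rightarrow> complex mat \<Rightarrow> bool" where
  "pos_def_hermitian n A \<longleftrightarrow> A \<in> carrier_mat n n \<and> mat_adjoint A = A \<and>
     (\<forall>v \<in> carrier_vec n. v \<noteq> 0\<^sub>v n \<longrightarrow> 0 < Re ((A *\<^sub>v v) \<bullet>c v))"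

definition pencil :: "complex mat \<Rightarrow> complex mat \<Rightarrow> complex mat \<Rightarrow> complex poly3 mat" where
  "pencil X Y Z =
     var_x \<cdot>\<^sub>m map_mat const3 X + var_y \<cdot>\<^sub>m map_mat const3 Y + var_z \<cdot>\<^sub>m map_mat const3 Z"

text \<open>
  The determinant is taken in \<open>\<complex>[x, y, z]\<close>; \<open>Poly_Mapping.map of_real\<close> is the inclusion of
  \<open>\<real>[x, y, z]\<close> into \<open>\<complex>[x, y, z]\<close>.
\<close>

definition detH :: "nat \<Rightarrow> real poly3 set" where
  "detH n = {F. homogeneous3 n F \<and>
     (\<exists>X Y Z. pos_def_hermitian n X \<and> pos_def_hermitian n Y \<and> pos_def_hermitian n Z \<and>
        Poly_Mapping.map complex_of_real F = det (pencil X Y Z))}"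

definition log_coeffs :: "nat \<Rightarrow> real poly3 \<Rightarrow> triple \<Rightarrow> real" where
  "log_coeffs n F = (\<lambda>d. if d \<in> Delta n then ln (Poly_Mapping.lookup F d) else 0)"

end

theory Submission
  imports "HOL-Analysis.Brouwer_Fixpoint" "HOL-Analysis.Function_Topology" Defs
begin

text \<open>
  Both inclusions compare logarithms of coefficients with hives up to an additive error that
  depends on \<open>n\<close> only. The function \<open>i\<^sup>2 + j\<^sup>2 + k\<^sup>2\<close> violates each rhombus inequality by exactly
  \<open>2\<close>, so subtracting a multiple of it turns a function that satisfies the inequalities up to a
  constant into a hive, and a hive into one that stays a hive under bounded perturbations. This
  is where the two vectors come from.

  For the first inclusion, let \<open>F\<close> be \<open>det (x X + y Y + z Z)\<close> with positive definite \<open>X\<close>, \<open>Y\<close>,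
  \<open>Z\<close>. Evaluating the three quadratic forms at a kernel vector shows that \<open>F\<close> does not vanish when each of \<open>x\<close>, \<open>y\<close>,
  \<open>z\<close> is \<open>0\<close> or lies in a common open half-plane of \<open>\<complex>\<close> bounded by a line through \<open>0\<close>, unless all
  three are \<open>0\<close> (\<open>det_pencil_nonzero\<close>). By an argument of Gauss and Lucas the partial derivatives
  inherit this (\<open>half_plane_stable_shift_x\<close>). The four coefficients in a rhombus are, up to
  factorials, coefficients of one quadratic form obtained from \<open>F\<close> by differentiation, and the
  rhombus inequality up to a factor \<open>2\<close> is the statement that the discriminant of this form in
  one variable is nonnegative at a suitable point (\<open>stable_quadratic\<close>). The same logarithmic
  derivatives give the positivity of the coefficients (\<open>stable_coeffs_pos\<close>).

  For the second inclusion, a hive \<open>g\<close> is turned into an explicit pencil: up to a scalar,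
  \<open>X = A A\<^sup>T\<close>, \<open>Y\<close> is the identity and \<open>Z\<close> is diagonal, where \<open>A\<close> is the path matrix of a planar
  network and \<open>Z\<close> is read off from the edge \<open>i = 0\<close> of \<open>g\<close>. Expanding the determinant by rows and
  the principal minors of \<open>A A\<^sup>T\<close> by the Cauchy-Binet formula writes each coefficient as a sum of
  nonnegative terms, in number bounded in terms of \<open>n\<close>. One of the terms at \<open>(i, j, k)\<close> is
  \<open>exp (g (i, j, k)) / i!\<close> (\<open>net_coeff_lower\<close>), and the hive inequalities imply that all the others
  are at most a constant times \<open>exp (g (i, j, k))\<close> (\<open>net_coeff_upper\<close>). The latter is the heart of
  the matter. A minor of \<open>A\<close> is expanded one layer of the network at a time; removing a layer
  replaces a hive of size \<open>n\<close> by the hive of size \<open>n - 1\<close> formed by its rows \<open>i \<ge> 1\<close>, and the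
  rhombus inequalities say that the slopes of consecutive rows interlace, which controls the
  change of weight (\<open>advance\<close>, \<open>net_minor_upper\<close>).

  Hence the logarithm of the coefficient vector is \<open>g\<close> plus a bounded continuous error, and a
  Brouwer fixed point in a cube around a given deep hive produces a \<open>g\<close> for which the logarithm
  equals that hive exactly (\<open>deep_hives_realised\<close>).
\<close>

section \<open>Determinants as sums over choices in the rows\<close>

lemma det_mat_permutations:
  fixes f :: "nat \<Rightarrow> nat \<Rightarrow> 'a::comm_ring_1"
  shows "det (mat m m (\<lambda>(i, j). f i j)) =
    (\<Sum>p | p permutes {..<m}. of_int (sign p) * (\<Prod>i<m. f i (p i)))"
proof -
  have "(\<Prod>i = 0..<m. mat m m (\<lambda>(i, j). f i j) $$ (i, p i)) = (\<Prod>i<m. f i (p i))"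
    if "p permutes {..<m}" for p
    unfolding atLeast0LessThan using permutes_in_image[OF that] by (intro prod.cong) auto
  then show ?thesis
    by (subst det_def'[of _ m]) (auto simp: atLeast0LessThan intro!: sum.cong)
qed

text \<open>
  Multilinearity in the rows, with a separate finite index set for each row. The expansion of a
  pencil into words, the Cauchy-Binet formula and the expansion of minors along a network are all
  instances.
\<close>

lemma det_mat_sum:
  fixes g :: "nat \<Rightarrow> 'b \<Rightarrow> nat \<Rightarrow> 'a::comm_ring_1"
  assumes "\<And>i. i < m \<Longrightarrow> finite (L i)"
  shows "det (mat m m (\<lambda>(i, j). \<Sum>l\<in>L i. g i l j)) =
    (\<Sum>\<phi>\<in>PiE {..<m} L. det (mat m m (\<lambda>(i, j). g i (\<phi> i) j)))"
proof -
  have "(\<Prod>i<m. \<Sum>l\<in>L i. g i l (p i)) = (\<Sum>\<phi>\<in>PiE {..<m} L. \<Prod>i<m. g i (\<phi> i) (p i))" for p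
    by (rule prod_sum_PiE) (use assms in auto)
  then show ?thesis
    unfolding det_mat_permutations by (simp add: sum_distrib_left) (rule sum.swap)
qed

lemma det_mat_scale_rows:
  fixes f :: "nat \<Rightarrow> nat \<Rightarrow> 'a::comm_ring_1"
  shows "det (mat m m (\<lambda>(i, j). c i * f i j)) = (\<Prod>i<m. c i) * det (mat m m (\<lambda>(i, j). f i j))"
  unfolding det_mat_permutations by (simp add: prod.distrib sum_distrib_left algebra_simps)

lemma det_mat_zero_column:
  fixes f :: "nat \<Rightarrow> nat \<Rightarrow> 'a::comm_ring_1"
  assumes "q < m" "\<And>i. i < m \<Longrightarrow> f i q = 0"
  shows "det (mat m m (\<lambda>(i, j). f i j)) = 0"
  unfolding det_mat_permutations
proof (intro sum.neutral ballI)
  fix p assume "p \<in> {p. p permutes {..<m}}"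
  then have p: "p permutes {..<m}" by simp
  then obtain i where i: "p i = q" by (metis permutes_def)
  then have "i < m" using permutes_in_image[OF p, of i] assms(1) by auto
  then have "(\<Prod>i<m. f i (p i)) = 0" using i assms(2) by (intro prod_zero) auto
  then show "of_int (sign p) * (\<Prod>i<m. f i (p i)) = 0" by simp
qed

lemma det_mat_laplace_last_row:
  fixes f :: "nat \<Rightarrow> nat \<Rightarrow> 'a::comm_ring_1"
  shows "det (mat (Suc m) (Suc m) (\<lambda>(i, j). f i j)) =
    (\<Sum>q\<le>m. (-1) ^ (m + q) * f m q * det (mat m m (\<lambda>(i, j). f i (if j < q then j else Suc j))))"
proof -
  let ?A = "mat (Suc m) (Suc m) (\<lambda>(i, j). f i j)"
  have "mat_delete ?A m q = mat m m (\<lambda>(i, j). f i (if j < q then j else Suc j))" if "q \<le> m" for q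
    unfolding mat_delete_def using that by (intro eq_matI) auto
  then show ?thesis
    by (subst laplace_expansion_row[of _ "Suc m" m])
       (auto simp: cofactor_def lessThan_Suc_atMost algebra_simps intro!: sum.cong)
qed

text \<open>
  All rows are changed at once, each by a multiple of the original next row, so this is the
  multiplication by a bidiagonal unipotent matrix.
\<close>

lemma det_mat_subtract_next_row:
  fixes f :: "nat \<Rightarrow> nat \<Rightarrow> 'a::comm_ring_1"
  shows "det (mat (Suc m) (Suc m) (\<lambda>(i, j). if i < m then f i j - r i * f (Suc i) j else f i j)) =
    det (mat (Suc m) (Suc m) (\<lambda>(i, j). f i j))"
proof -
  let ?U = "mat (Suc m) (Suc m) (\<lambda>(i, k). if k = i then 1 else if k = Suc i then - r i else 0)"
  let ?A = "mat (Suc m) (Suc m) (\<lambda>(i, j). f i j)"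
  have "mat (Suc m) (Suc m) (\<lambda>(i, j). if i < m then f i j - r i * f (Suc i) j else f i j) = ?U * ?A"
    (is "?B = _")
  proof (rule eq_matI)
    fix i j assume ij: "i < dim_row (?U * ?A)" "j < dim_col (?U * ?A)"
    have "(?U * ?A) $$ (i, j) =
      (\<Sum>k<Suc m. (if k = i then 1 else if k = Suc i then - r i else 0) * f k j)"
      using ij by (auto simp: times_mat_def scalar_prod_def atLeast0LessThan intro!: sum.cong)
    also have "\<dots> = (\<Sum>k<Suc m. (if k = i then f k j else 0) + (if k = Suc i then - r i * f k j else 0))"
      by (intro sum.cong) auto
    also have "\<dots> = ?B $$ (i, j)"
      using ij by (simp add: sum.distrib sum.delta del: sum.lessThan_Suc)
    finally show "?B $$ (i, j) = (?U * ?A) $$ (i, j)" ..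
  qed auto
  moreover have "det ?U = 1"
  proof -
    have "diag_mat ?U = map (\<lambda>_. 1) [0..<Suc m]"
      unfolding diag_mat_def by (intro map_cong) auto
    moreover have "prod_list (map (\<lambda>_. 1 :: 'a) [0..<Suc m]) = 1"
      by (intro prod_list_neutral) auto
    ultimately show ?thesis
      by (subst det_upper_triangular[of _ "Suc m"]) auto
  qed
  ultimately show ?thesis
    by (simp add: det_mult[of _ "Suc m"])
qed

section \<open>A triangular matrix with prescribed leading minors\<close>

text \<open>
  The path matrix of a planar network with \<open>n\<close> layers. In layer \<open>t\<close> a path starting at \<open>s\<close> either
  ends in column \<open>t\<close>, with weight \<open>c t s\<close>, or passes to the next layer at some \<open>l \<ge> s\<close>, with weight
  \<open>c t s / c t l\<close>. The weights are chosen such that subtracting from row \<open>s\<close> the multiple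
  \<open>c t s / c t s'\<close> of a later row \<open>s'\<close> removes both the entry in column \<open>t\<close> and all \<open>l \<ge> s'\<close>. The
  \<open>c t s\<close> with \<open>t + s < n\<close> are free positive parameters, as many as the minors formed by
  consecutive rows and the first columns.
\<close>

function net :: "nat \<Rightarrow> (nat \<Rightarrow> nat \<Rightarrow> real) \<Rightarrow> nat \<Rightarrow> nat \<Rightarrow> nat \<Rightarrow> real" where
  "net n c t s u = (if u < t then 0 else if u = t then c t s
     else (\<Sum>l\<in>{s..<n - Suc t}. c t s / c t l * net n c (Suc t) l u))"

  by auto
termination
  by (relation "measure (\<lambda>(n, c, t, s, u). Suc u - t)") auto

declare net.simps [simp del]

lemma net_below [simp]: "u < t \<Longrightarrow> net n c t s u = 0"
  by (subst net.simps) simp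

lemma net_diagonal [simp]: "net n c t s t = c t s"
  by (subst net.simps) simp

lemma net_above:
  "t < u \<Longrightarrow> net n c t s u = (\<Sum>l\<in>{s..<n - Suc t}. c t s / c t l * net n c (Suc t) l u)"
  by (subst net.simps) simp

definition net_minor :: "nat \<Rightarrow> (nat \<Rightarrow> nat \<Rightarrow> real) \<Rightarrow> nat \<Rightarrow> nat \<Rightarrow> (nat \<Rightarrow> nat) \<Rightarrow> (nat \<Rightarrow> nat) \<Rightarrow> real" where
  "net_minor n c t m s f = det (mat m m (\<lambda>(i, j). net n c t (s i) (f j)))"

lemma net_minor_cong:
  assumes "\<And>r. r < m \<Longrightarrow> s r = s' r" "\<And>q. q < m \<Longrightarrow> f q = f' q"
  shows "net_minor n c t m s f = net_minor n c t m s' f'"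
  unfolding net_minor_def by (rule arg_cong[where f = det], rule cong_mat) (use assms in auto)

lemma net_subtract:
  assumes "\<And>t s. c t s > 0" "s < s'" "s' < n - t"
  shows "net n c t s u - c t s / c t s' * net n c t s' u =
    (\<Sum>l\<in>{s..<s'}. c t s / c t l * net n c (Suc t) l u)"
proof -
  have nz: "c t l \<noteq> 0" for t l using assms(1)[of t l] by simp
  consider "u < t" | "u = t" | "u > t" by linarith
  then show ?thesis
  proof cases
    case 3
    have "{s..<n - Suc t} = {s..<s'} \<union> {s'..<n - Suc t}" using assms by auto
    then have "(\<Sum>l\<in>{s..<n - Suc t}. c t s / c t l * net n c (Suc t) l u) =
      (\<Sum>l\<in>{s..<s'}. c t s / c t l * net n c (Suc t) l u) +
      (\<Sum>l\<in>{s'..<n - Suc t}. c t s / c t l * net n c (Suc t) l u)"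
      by (simp add: sum.union_disjoint ivl_disj_int)
    moreover have "c t s / c t s' * net n c t s' u =
        (\<Sum>l\<in>{s'..<n - Suc t}. c t s / c t l * net n c (Suc t) l u)"
      using 3 nz by (simp add: net_above sum_distrib_left)
    ultimately show ?thesis using 3 by (simp add: net_above)
  qed (use nz in simp_all)
qed

text \<open>
  One layer is removed from a minor: subtracting from each row the appropriate multiple of the next
  one leaves, in row \<open>r\<close>, only the start points between \<open>s r\<close> and \<open>s (Suc r)\<close> of the next layer.
  Expanding the last row, which has no successor, lowers the size of the minor by one. These
  intervals are disjoint, so the new row numbers are increasing again.
\<close>

lemma net_minor_Suc:
  assumes c: "\<And>t s. c t s > 0"
    and s: "\<And>r. r < m \<Longrightarrow> s r < s (Suc r)" "s m < n - t"
  shows "net_minor n c t (Suc m) s f =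
    (\<Sum>q\<le>m. (-1) ^ (m + q) * net n c t (s m) (f q) *
       (\<Sum>\<phi>\<in>(\<Pi>\<^sub>E r\<in>{..<m}. {s r..<s (Suc r)}). (\<Prod>r<m. c t (s r) / c t (\<phi> r)) *
          net_minor n c (Suc t) m \<phi> (\<lambda>j. f (if j < q then j else Suc j))))"
proof -
  have le: "s r \<le> s m" if "r \<le> m" for r
    using that by (induction rule: inc_induct) (auto dest!: s(1))
  let ?v = "\<lambda>i u. if i < m then net n c t (s i) u - c t (s i) / c t (s (Suc i)) * net n c t (s (Suc i)) u
    else net n c t (s i) u"
  have v: "?v i u = (\<Sum>l\<in>{s i..<s (Suc i)}. c t (s i) / c t l * net n c (Suc t) l u)" if "i < m" for i u
    using that s le[of "Suc i"] by (subst net_subtract[OF c, symmetric]) auto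
  have "net_minor n c t (Suc m) s f = det (mat (Suc m) (Suc m) (\<lambda>(i, j). ?v i (f j)))"
    unfolding net_minor_def
    by (subst det_mat_subtract_next_row[of m "\<lambda>i j. net n c t (s i) (f j)" "\<lambda>i. c t (s i) / c t (s (Suc i))", symmetric]) simp
  also have "\<dots> = (\<Sum>q\<le>m. (-1) ^ (m + q) * net n c t (s m) (f q) *
      det (mat m m (\<lambda>(i, j). ?v i (f (if j < q then j else Suc j)))))"
    by (subst det_mat_laplace_last_row) simp
  also have "\<dots> = (\<Sum>q\<le>m. (-1) ^ (m + q) * net n c t (s m) (f q) *
      det (mat m m (\<lambda>(i, j). \<Sum>l\<in>{s i..<s (Suc i)}. c t (s i) / c t l *
         net n c (Suc t) l (f (if j < q then j else Suc j)))))"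
  proof (intro sum.cong refl arg_cong2[where f = "(*)"])
    fix q
    show "det (mat m m (\<lambda>(i, j). ?v i (f (if j < q then j else Suc j)))) =
      det (mat m m (\<lambda>(i, j). \<Sum>l\<in>{s i..<s (Suc i)}. c t (s i) / c t l *
         net n c (Suc t) l (f (if j < q then j else Suc j))))"
      by (rule arg_cong[where f = det], rule cong_mat, rule refl, rule refl, unfold prod.case, rule v)
  qed
  also have "\<dots> = (\<Sum>q\<le>m. (-1) ^ (m + q) * net n c t (s m) (f q) *
       (\<Sum>\<phi>\<in>(\<Pi>\<^sub>E r\<in>{..<m}. {s r..<s (Suc r)}). (\<Prod>r<m. c t (s r) / c t (\<phi> r)) *
          net_minor n c (Suc t) m \<phi> (\<lambda>j. f (if j < q then j else Suc j))))"
    unfolding net_minor_def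
    by (subst det_mat_sum) (simp_all only: finite_atLeastLessThan det_mat_scale_rows)
  finally show ?thesis .
qed

text \<open>
  This estimates the last row in the expansion above. It needs that the parameters decrease from
  layer to layer, for then a path does not gain weight by postponing its end.
\<close>

lemma net_bound:
  assumes c: "\<And>t s. c t s > 0" and mono: "\<And>t s. t + s + 2 \<le> n \<Longrightarrow> c (Suc t) s \<le> c t s"
    and "s < n - t"
  shows "\<bar>net n c t s u\<bar> \<le> real n ^ (u - t) * c t s"
  using assms(3)
proof (induction "u - t" arbitrary: t s u)
  case 0
  then show ?case using c[of t s] by (cases "u = t") auto
next
  case (Suc k)
  then have u: "u > t" by auto
  have k: "u - t = Suc k" "u - Suc t = k" using Suc.hyps by auto
  have "\<bar>net n c t s u\<bar> \<le> (\<Sum>l\<in>{s..<n - Suc t}. \<bar>c t s / c t l * net n c (Suc t) l u\<bar>)"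
    using u by (simp only: net_above) (rule sum_abs)
  also have "\<dots> \<le> (\<Sum>l\<in>{s..<n - Suc t}. real n ^ k * c t s)"
  proof (rule sum_mono)
    fix l assume l: "l \<in> {s..<n - Suc t}"
    have "\<bar>net n c (Suc t) l u\<bar> \<le> real n ^ k * c (Suc t) l"
      using Suc.hyps(1)[of u "Suc t" l] k l by simp
    also have "\<dots> \<le> real n ^ k * c t l"
      using mono[of t l] l by (intro mult_left_mono) auto
    finally have "\<bar>net n c (Suc t) l u\<bar> \<le> real n ^ k * c t l" .
    then have "c t s / c t l * \<bar>net n c (Suc t) l u\<bar> \<le> c t s / c t l * (real n ^ k * c t l)"
      using c[of t s] c[of t l] by (intro mult_left_mono) auto
    also have "\<dots> = real n ^ k * c t s" using c[of t l] by simp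
    finally show "\<bar>c t s / c t l * net n c (Suc t) l u\<bar> \<le> real n ^ k * c t s"
      using c[of t s] c[of t l] by (simp add: abs_mult)
  qed
  also have "\<dots> = real (n - Suc t - s) * (real n ^ k * c t s)" by simp
  also have "\<dots> \<le> real n * (real n ^ k * c t s)"
    using c[of t s] by (intro mult_right_mono) auto
  finally show ?case by (simp add: k)
qed

text \<open>
  For consecutive rows each of the intervals is a single point, and for the first columns only the
  column \<open>t\<close> contributes to the expansion of the last row, because deeper layers vanish there.
\<close>

lemma net_minor_leading:
  assumes c: "\<And>t s. c t s > 0" and "a + m \<le> n - t"
  shows "\<bar>net_minor n c t m (\<lambda>r. a + r) (\<lambda>q. t + q)\<bar> = (\<Prod>q<m. c (t + q) (a + m - Suc q))"
  using assms(2)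
proof (induction m arbitrary: t)
  case 0
  then show ?case by (simp add: net_minor_def)
next
  case (Suc m)
  let ?\<phi> = "\<lambda>r\<in>{..<m}. a + r"
  have single: "(\<Pi>\<^sub>E r\<in>{..<m}. {a + r..<a + Suc r}) = {?\<phi>}"
  proof -
    have "(\<Pi>\<^sub>E r\<in>{..<m}. {a + r..<a + Suc r}) = (\<Pi>\<^sub>E r\<in>{..<m}. {?\<phi> r})"
      by (rule PiE_cong) auto
    also have "\<dots> = {?\<phi>}" by (rule PiE_singleton, rule restrict_extensional)
    finally show ?thesis .
  qed
  have minor_cong: "net_minor n c (Suc t) m ?\<phi> f = net_minor n c (Suc t) m (\<lambda>r. a + r) f" for f
    by (rule net_minor_cong) simp_all
  have zero: "net_minor n c (Suc t) m s (\<lambda>j. t + (if j < q then j else Suc j)) = 0"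
    if "0 < q" "q \<le> m" for q s
    unfolding net_minor_def
    by (rule det_mat_zero_column[of 0]) (use that in auto)
  have nz: "c t (a + r) \<noteq> 0" for r using c[of t "a + r"] by simp
  have "net_minor n c t (Suc m) (\<lambda>r. a + r) (\<lambda>q. t + q) =
    (\<Sum>q\<le>m. (-1) ^ (m + q) * net n c t (a + m) (t + q) *
      net_minor n c (Suc t) m (\<lambda>r. a + r) (\<lambda>j. t + (if j < q then j else Suc j)))"
    using Suc.prems nz by (subst net_minor_Suc[OF c]) (simp_all only: single, auto simp: minor_cong)
  also have "\<dots> = (\<Sum>q\<in>{0}. (-1) ^ (m + q) * net n c t (a + m) (t + q) *
      net_minor n c (Suc t) m (\<lambda>r. a + r) (\<lambda>j. t + (if j < q then j else Suc j)))"
    by (rule sum.mono_neutral_right) (auto simp: zero)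
  also have "\<dots> = (-1) ^ m * c t (a + m) * net_minor n c (Suc t) m (\<lambda>r. a + r) (\<lambda>j. Suc t + j)"
    by simp
  finally have "\<bar>net_minor n c t (Suc m) (\<lambda>r. a + r) (\<lambda>q. t + q)\<bar> =
      c t (a + m) * \<bar>net_minor n c (Suc t) m (\<lambda>r. a + r) (\<lambda>j. Suc t + j)\<bar>"
    using c[of t "a + m"] by (simp add: abs_mult power_abs)
  also have "\<dots> = (\<Prod>q<Suc m. c (t + q) (a + Suc m - Suc q))"
    using Suc.prems by (subst Suc.IH) (auto simp: prod.lessThan_Suc_shift simp del: prod.lessThan_Suc)
  finally show ?case .
qed

section \<open>Hives and the size of the minors\<close>

text \<open>
  The hive inequalities for \<open>H t u = g (t, u, n - t - u)\<close>. The row \<open>t\<close> is the power of \<open>x\<close>.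
\<close>

definition rhombus_concave :: "nat \<Rightarrow> (nat \<Rightarrow> nat \<Rightarrow> real) \<Rightarrow> bool" where
  "rhombus_concave n H \<longleftrightarrow> (\<forall>t u. t + u + 2 \<le> n \<longrightarrow>
     H t u + H (Suc t) (Suc u) \<le> H (Suc t) u + H t (Suc u) \<and>
     H t (Suc (Suc u)) + H (Suc t) u \<le> H (Suc t) (Suc u) + H t (Suc u) \<and>
     H (Suc (Suc t)) u + H t (Suc u) \<le> H (Suc t) (Suc u) + H (Suc t) u)"

text \<open>
  The differences of a hive in the directions \<open>(0, 1, -1)\<close> and \<open>(1, -1, 0)\<close>. In these terms the
  rhombus inequalities say that the slopes in row \<open>Suc t\<close> interlace those in row \<open>t\<close>, and that the
  drift decreases from row to row.
\<close>

definition slope :: "(nat \<Rightarrow> nat \<Rightarrow> real) \<Rightarrow> nat \<Rightarrow> nat \<Rightarrow> real" where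
  "slope H t u = H t (Suc u) - H t u"

definition drift :: "(nat \<Rightarrow> nat \<Rightarrow> real) \<Rightarrow> nat \<Rightarrow> nat \<Rightarrow> real" where
  "drift H t s = H (Suc t) s - H t (Suc s)"

lemma slope_Suc_le:
  "rhombus_concave n H \<Longrightarrow> t + u + 2 \<le> n \<Longrightarrow> slope H (Suc t) u \<le> slope H t u"
  unfolding rhombus_concave_def slope_def by (drule spec[of _ t], drule spec[of _ u]) auto

lemma slope_shift_le:
  "rhombus_concave n H \<Longrightarrow> t + u + 2 \<le> n \<Longrightarrow> slope H t (Suc u) \<le> slope H (Suc t) u"
  unfolding rhombus_concave_def slope_def by (drule spec[of _ t], drule spec[of _ u]) auto

lemma drift_Suc_le:
  "rhombus_concave n H \<Longrightarrow> t + u + 2 \<le> n \<Longrightarrow> drift H (Suc t) u \<le> drift H t u"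
  unfolding rhombus_concave_def drift_def by (drule spec[of _ t], drule spec[of _ u]) auto

lemma sum_slope: "(\<Sum>u<j. slope H t u) = H t j - H t 0"
  unfolding slope_def by (rule sum_lessThan_telescope)

lemma drift_0: "drift H t s = H (Suc t) 0 - H t 0 + (\<Sum>u<s. slope H (Suc t) u) - (\<Sum>u<Suc s. slope H t u)"
  unfolding sum_slope drift_def by simp

lemma drift_diff:
  assumes "l \<le> s"
  shows "drift H t s - drift H t l = (\<Sum>u\<in>{l..<s}. slope H (Suc t) u) - (\<Sum>u\<in>{Suc l..<Suc s}. slope H t u)"
proof -
  have "(\<Sum>u\<in>{l..<s}. slope H (Suc t) u) = H (Suc t) s - H (Suc t) l"
    unfolding slope_def using assms by (rule sum_Suc_diff')
  moreover have "(\<Sum>u\<in>{Suc l..<Suc s}. slope H t u) = H t (Suc s) - H t (Suc l)"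
    unfolding slope_def using assms by (intro sum_Suc_diff') simp
  ultimately show ?thesis unfolding drift_def by simp
qed

text \<open>
  The positions above \<open>s\<close>, moved down by one. This is how positions in row \<open>t\<close> become positions in
  row \<open>Suc t\<close>, which is shorter by one, without a loss in slope.
\<close>

definition pull :: "nat \<Rightarrow> nat set \<Rightarrow> nat set" where
  "pull s T = (\<lambda>u. u - 1) ` {u \<in> T. s < u}"

lemma inj_on_pred: "inj_on (\<lambda>u::nat. u - 1) {u \<in> T. s < u}"
  by (auto simp: inj_on_def)

lemma card_pull: "card (pull s T) = card {u \<in> T. s < u}"
  unfolding pull_def by (rule card_image[OF inj_on_pred])

lemma slope_pull:
  assumes "rhombus_concave n H" "T \<subseteq> {..<N}" "N \<le> n - t"
  shows "(\<Sum>u | u \<in> T \<and> s < u. slope H t u) \<le> (\<Sum>u\<in>pull s T. slope H (Suc t) u)"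
proof -
  have "slope H t u \<le> slope H (Suc t) (u - 1)" if "u \<in> {u \<in> T. s < u}" for u
    using slope_shift_le[OF assms(1), of t "u - 1"] that assms(2,3) by (cases u) force+
  then show ?thesis
    unfolding pull_def sum.reindex[OF inj_on_pred] o_def by (rule sum_mono)
qed

text \<open>
  Passing from row \<open>t\<close> to row \<open>Suc t\<close> at a position outside \<open>T\<close> contributes the negative of a drop
  in slope and can be discarded.
\<close>

lemma slope_gap:
  assumes "rhombus_concave n H" "b < n - t" "finite T"
  shows "(\<Sum>u\<in>{a..<b}. slope H (Suc t) u) - (\<Sum>u\<in>{a..<b} - T. slope H t u)
    \<le> (\<Sum>u\<in>{a..<b} \<inter> T. slope H (Suc t) u)"
proof -
  have "(\<Sum>u\<in>{a..<b}. slope H (Suc t) u) =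
    (\<Sum>u\<in>{a..<b} \<inter> T. slope H (Suc t) u) + (\<Sum>u\<in>{a..<b} - T. slope H (Suc t) u)"
    by (subst sum.union_disjoint[symmetric]) (auto intro: sum.cong)
  moreover have "(\<Sum>u\<in>{a..<b} - T. slope H (Suc t) u) \<le> (\<Sum>u\<in>{a..<b} - T. slope H t u)"
    using assms by (intro sum_mono slope_Suc_le[of n]) auto
  ultimately show ?thesis by simp
qed

text \<open>
  The next three lemmas bound the exponents that arise when a layer is removed from a minor. A set
  \<open>T\<close> of positions carries the sum of its slopes, and the row numbers of the minor form a subset of
  \<open>T\<close> and carry drifts in addition. A drift is a sum of slopes in row \<open>Suc t\<close> minus a sum of slopes in
  row \<open>t\<close>. Positions in \<open>T\<close> below \<open>s\<close> therefore cancel against the second sum and survive through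
  the first, the position \<open>s\<close> cancels entirely, and those above \<open>s\<close> are moved down by one.
\<close>

lemma advance_lowest:
  assumes "rhombus_concave n H" "T \<subseteq> {..<N}" "N \<le> n - t" "s \<in> T"
  shows "\<exists>T'\<subseteq>{..<N - 1}. card T = Suc (card T') \<and>
    (\<Sum>u\<in>T. slope H t u) + drift H t s \<le> H (Suc t) 0 - H t 0 + (\<Sum>u\<in>T'. slope H (Suc t) u)"
proof -
  have fin: "finite T" using assms(2) finite_subset by blast
  have sN: "s < N" using assms by auto
  let ?T' = "({0..<s} \<inter> T) \<union> pull s T"
  have sub: "pull s T \<subseteq> {s..<N - 1}"
    using assms(2) unfolding pull_def by force
  have disj: "({0..<s} \<inter> T) \<inter> pull s T = {}"
    using sub by auto
  have finp: "finite (pull s T)" using sub finite_subset by blast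
  have T: "T = ({0..<s} \<inter> T) \<union> ({s} \<union> {u \<in> T. s < u})"
    using assms(4) by auto
  have cardT: "card T = card ({0..<s} \<inter> T) + Suc (card {u \<in> T. s < u})"
    by (subst T, subst card_Un_disjoint) (use fin in auto)
  have "(\<Sum>u\<in>T. slope H t u) =
      (\<Sum>u\<in>{0..<s} \<inter> T. slope H t u) + (slope H t s + (\<Sum>u | u \<in> T \<and> s < u. slope H t u))"
    by (subst T, subst sum.union_disjoint) (use fin in auto)
  moreover have "(\<Sum>u<s. slope H t u) = (\<Sum>u\<in>{0..<s} \<inter> T. slope H t u) + (\<Sum>u\<in>{0..<s} - T. slope H t u)"
    by (subst sum.union_disjoint[symmetric]) (auto intro: sum.cong)
  moreover have "(\<Sum>u\<in>?T'. slope H (Suc t) u) =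
      (\<Sum>u\<in>{0..<s} \<inter> T. slope H (Suc t) u) + (\<Sum>u\<in>pull s T. slope H (Suc t) u)"
    using disj finp by (intro sum.union_disjoint) auto
  moreover have "(\<Sum>u\<in>{0..<s}. slope H (Suc t) u) - (\<Sum>u\<in>{0..<s} - T. slope H t u)
    \<le> (\<Sum>u\<in>{0..<s} \<inter> T. slope H (Suc t) u)"
    using sN assms(3) fin by (intro slope_gap[OF assms(1)]) auto
  moreover have "(\<Sum>u | u \<in> T \<and> s < u. slope H t u) \<le> (\<Sum>u\<in>pull s T. slope H (Suc t) u)"
    by (rule slope_pull[OF assms(1-3)])
  ultimately have "(\<Sum>u\<in>T. slope H t u) + drift H t s \<le> H (Suc t) 0 - H t 0 + (\<Sum>u\<in>?T'. slope H (Suc t) u)"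
    by (simp add: drift_0 atLeast0LessThan)
  moreover have "card T = Suc (card ?T')"
    using cardT disj finp by (simp add: card_Un_disjoint card_pull)
  moreover have "?T' \<subseteq> {..<N - 1}" using sub sN by fastforce
  ultimately show ?thesis by blast
qed

text \<open>
  The same for a row number \<open>s\<close> that is not the lowest. Only the positions between the chosen start
  point \<open>l\<close> of the next layer and \<open>s\<close> are affected by the difference of drifts, and \<open>s\<close> is
  replaced by \<open>l\<close> instead of disappearing.
\<close>

lemma advance_next:
  assumes "rhombus_concave n H" "T \<subseteq> {..<N}" "N \<le> n - t" "s \<in> T" "l < s"
  shows "\<exists>T'\<subseteq>{l..<N - 1}. l \<in> T' \<and> card T' = card {u \<in> T. l < u} \<and>
    (\<Sum>u | u \<in> T \<and> l < u. slope H t u) + drift H t s - drift H t l \<le> (\<Sum>u\<in>T'. slope H (Suc t) u)"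
proof -
  have fin: "finite T" using assms(2) finite_subset by blast
  have sN: "s < N" using assms by auto
  let ?G = "{Suc l..<s} \<inter> T"
  let ?T' = "({l} \<union> ?G) \<union> pull s T"
  have sub: "pull s T \<subseteq> {s..<N - 1}"
    using assms(2) unfolding pull_def by force
  have disj: "({l} \<union> ?G) \<inter> pull s T = {}"
    using sub assms(5) by auto
  have finp: "finite (pull s T)" using sub finite_subset by blast
  have T: "{u \<in> T. l < u} = ?G \<union> ({s} \<union> {u \<in> T. s < u})"
    using assms(4,5) by auto
  have cardT: "card {u \<in> T. l < u} = card ?G + Suc (card {u \<in> T. s < u})"
    by (subst T, subst card_Un_disjoint) (use fin in auto)
  have "(\<Sum>u | u \<in> T \<and> l < u. slope H t u) =
      (\<Sum>u\<in>?G. slope H t u) + (slope H t s + (\<Sum>u | u \<in> T \<and> s < u. slope H t u))"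
    by (subst T, subst sum.union_disjoint) (use fin in auto)
  moreover have "(\<Sum>u\<in>{Suc l..<Suc s}. slope H t u) =
      (\<Sum>u\<in>?G. slope H t u) + (\<Sum>u\<in>{Suc l..<s} - T. slope H t u) + slope H t s"
  proof -
    have "(\<Sum>u\<in>{Suc l..<s}. slope H t u) = (\<Sum>u\<in>?G. slope H t u) + (\<Sum>u\<in>{Suc l..<s} - T. slope H t u)"
      by (subst sum.union_disjoint[symmetric]) (auto intro: sum.cong)
    then show ?thesis using assms(5) by simp
  qed
  moreover have "(\<Sum>u\<in>?T'. slope H (Suc t) u) =
      slope H (Suc t) l + (\<Sum>u\<in>?G. slope H (Suc t) u) + (\<Sum>u\<in>pull s T. slope H (Suc t) u)"
    using disj finp by (subst sum.union_disjoint) auto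
  moreover have "(\<Sum>u\<in>{l..<s}. slope H (Suc t) u) = slope H (Suc t) l + (\<Sum>u\<in>{Suc l..<s}. slope H (Suc t) u)"
    using assms(5) by (rule sum.atLeast_Suc_lessThan)
  moreover have "(\<Sum>u\<in>{Suc l..<s}. slope H (Suc t) u) - (\<Sum>u\<in>{Suc l..<s} - T. slope H t u)
    \<le> (\<Sum>u\<in>?G. slope H (Suc t) u)"
    using sN assms(3) fin by (intro slope_gap[OF assms(1)]) auto
  moreover have "(\<Sum>u | u \<in> T \<and> s < u. slope H t u) \<le> (\<Sum>u\<in>pull s T. slope H (Suc t) u)"
    by (rule slope_pull[OF assms(1-3)])
  ultimately have "(\<Sum>u | u \<in> T \<and> l < u. slope H t u) + drift H t s - drift H t l \<le> (\<Sum>u\<in>?T'. slope H (Suc t) u)"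
    using drift_diff[of l s H t] assms(5) by simp
  moreover have "card ?T' = card {u \<in> T. l < u}"
    using cardT disj finp by (subst card_Un_disjoint) (simp_all add: card_pull)
  moreover have "?T' \<subseteq> {l..<N - 1}" using sub sN assms(5) by fastforce
  ultimately show ?thesis by (intro exI[of _ ?T']) auto
qed

text \<open>
  If \<open>T\<close> carries the row numbers \<open>s\<close> in layer \<open>t\<close>, and the next layer is entered at interlacing
  points \<open>l\<close>, then the exponent is bounded by the first difference of the hive in its edge \<open>u = 0\<close>
  plus the exponent of a set \<open>T'\<close> in the next row that contains \<open>l\<close> and has one element less. The
  pieces of \<open>T'\<close> for the single row numbers lie in disjoint intervals, which is why the bound \<open>N\<close> is
  kept variable in the induction.
\<close>

lemma advance:
  assumes H: "rhombus_concave n H"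
  shows "\<lbrakk>T \<subseteq> {..<N}; N \<le> n - t; s ` {..m} \<subseteq> T; \<And>r. r < m \<Longrightarrow> s r \<le> l r \<and> l r < s (Suc r)\<rbrakk> \<Longrightarrow>
    \<exists>T'\<subseteq>{..<N - 1}. l ` {..<m} \<subseteq> T' \<and> card T = Suc (card T') \<and>
      (\<Sum>u\<in>T. slope H t u) + (\<Sum>r\<le>m. drift H t (s r)) - (\<Sum>r<m. drift H t (l r))
      \<le> H (Suc t) 0 - H t 0 + (\<Sum>u\<in>T'. slope H (Suc t) u)"
proof (induction m arbitrary: T N)
  case 0
  then show ?case using advance_lowest[OF H, of T N t "s 0"] by simp
next
  case (Suc m)
  have fin: "finite T" using Suc.prems(1) finite_subset by blast
  (* The highest row number only moves positions above l m, the others only positions up to l m. *)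
  let ?lo = "{u \<in> T. u \<le> l m}" and ?hi = "{u \<in> T. l m < u}"
  have lm: "s m \<le> l m" "l m < s (Suc m)" using Suc.prems(4)[of m] by auto
  have sT: "s (Suc m) \<in> T" "s (Suc m) < N" using Suc.prems(1,3) by auto
  have le: "s r \<le> s m" if "r \<le> m" for r
    using that
  proof (induction rule: inc_induct)
    case (step r)
    then show ?case using Suc.prems(4)[of r] by linarith
  qed simp
  obtain T1 where T1: "T1 \<subseteq> {..<Suc (l m) - 1}" "l ` {..<m} \<subseteq> T1" "card ?lo = Suc (card T1)"
    "(\<Sum>u\<in>?lo. slope H t u) + (\<Sum>r\<le>m. drift H t (s r)) - (\<Sum>r<m. drift H t (l r))
      \<le> H (Suc t) 0 - H t 0 + (\<Sum>u\<in>T1. slope H (Suc t) u)"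
  proof -
    have "s ` {..m} \<subseteq> ?lo" using Suc.prems(3) le lm by force
    then show ?thesis
      using Suc.IH[of ?lo "Suc (l m)"] Suc.prems(2,4) lm sT that by force
  qed
  obtain T2 where T2: "T2 \<subseteq> {l m..<N - 1}" "l m \<in> T2" "card T2 = card ?hi"
    "(\<Sum>u\<in>?hi. slope H t u) + drift H t (s (Suc m)) - drift H t (l m) \<le> (\<Sum>u\<in>T2. slope H (Suc t) u)"
    using advance_next[OF H Suc.prems(1,2) sT(1) lm(2)] by auto
  have fin12: "finite T1" "finite T2" using T1(1) T2(1) finite_subset by blast+
  have disj: "T1 \<inter> T2 = {}" using T1(1) T2(1) by force
  have T: "T = ?lo \<union> ?hi" by auto
  have "(\<Sum>u\<in>T. slope H t u) = (\<Sum>u\<in>?lo. slope H t u) + (\<Sum>u\<in>?hi. slope H t u)"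
    by (subst T, subst sum.union_disjoint) (use fin in auto)
  moreover have "card T = card ?lo + card ?hi"
    by (subst T, subst card_Un_disjoint) (use fin in auto)
  ultimately show ?case
    using T1 T2 disj fin12 lm sT
    by (intro exI[of _ "T1 \<union> T2"])
       (fastforce simp: sum.union_disjoint card_Un_disjoint less_Suc_eq)
qed

lemma sum_decreasing_le_initial:
  fixes d :: "nat \<Rightarrow> real"
  assumes "\<And>u v. u \<le> v \<Longrightarrow> v < N \<Longrightarrow> d v \<le> d u"
  shows "T \<subseteq> {..<N} \<Longrightarrow> card T = j \<Longrightarrow> (\<Sum>u\<in>T. d u) \<le> (\<Sum>u<j. d u)"
proof (induction j arbitrary: T)
  case 0
  then show ?case using finite_subset by fastforce
next
  case (Suc j)
  have fin: "finite T" using Suc.prems(1) finite_subset by blast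
  then have ne: "T \<noteq> {}" using Suc.prems(2) by auto
  have M: "Max T \<in> T" using fin ne by simp
  have "T \<subseteq> {..Max T}" using fin by auto
  then have "Suc j \<le> Suc (Max T)"
    using Suc.prems(2) card_mono[of "{..Max T}" T] by simp
  then have "d (Max T) \<le> d j" using M Suc.prems(1) by (intro assms) auto
  moreover have "(\<Sum>u\<in>T - {Max T}. d u) \<le> (\<Sum>u<j. d u)"
    using Suc.prems M fin by (intro Suc.IH) auto
  ultimately show ?case using fin M by (simp add: sum.remove)
qed

lemma slope_decreasing:
  assumes "rhombus_concave n H" "u \<le> v" "v < n - t"
  shows "slope H t v \<le> slope H t u"
  using assms(2,3)
proof (induction v rule: dec_induct)
  case (step v)
  have "slope H t (Suc v) \<le> slope H (Suc t) v" "slope H (Suc t) v \<le> slope H t v"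
    using step.prems by (intro slope_shift_le[OF assms(1)] slope_Suc_le[OF assms(1)]; simp)+
  then show ?case using step by simp
qed simp

definition weight :: "(nat \<Rightarrow> nat \<Rightarrow> real) \<Rightarrow> nat \<Rightarrow> nat \<Rightarrow> real" where
  "weight H t s = exp (drift H t s / 2)"

text \<open>
  Each removed layer costs one first difference of the hive in its edge \<open>u = 0\<close>, and when no row is
  left, \<open>T\<close> has \<open>j\<close> elements whose slopes are at most the first \<open>j\<close> slopes of row \<open>t + m\<close>. The sum of
  these telescopes to \<open>H (t + m) j - H t 0\<close>. The exponents are halved because the bound concerns a
  minor and not its square.
\<close>

lemma net_minor_upper:
  assumes n: "n \<ge> 1"
  shows "\<exists>K>0. \<forall>H t s f T j. rhombus_concave n H \<longrightarrow> (\<forall>r. Suc r < m \<longrightarrow> s r < s (Suc r)) \<longrightarrow>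
    T \<subseteq> {..<n - t} \<longrightarrow> s ` {..<m} \<subseteq> T \<longrightarrow> card T = m + j \<longrightarrow> (\<forall>q<m. f q < n) \<longrightarrow>
    exp ((\<Sum>u\<in>T. slope H t u) / 2) * \<bar>net_minor n (weight H) t m s f\<bar>
      \<le> K * exp ((H (t + m) j - H t 0) / 2)"
proof (induction m)
  case 0
  show ?case
  proof (intro exI[of _ 1] conjI allI impI)
    fix H t s f T j
    assume H: "rhombus_concave n H" and T: "T \<subseteq> {..<n - t}" "card T = 0 + j"
    have "(\<Sum>u\<in>T. slope H t u) \<le> (\<Sum>u<j. slope H t u)"
      using T by (intro sum_decreasing_le_initial[of "n - t"] slope_decreasing[OF H]) auto
    then show "exp ((\<Sum>u\<in>T. slope H t u) / 2) * \<bar>net_minor n (weight H) t 0 s f\<bar>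
      \<le> 1 * exp ((H (t + 0) j - H t 0) / 2)"
      by (simp add: net_minor_def sum_slope)
  qed simp
next
  case (Suc m)
  then obtain K where K: "K > 0" "\<And>H t s f T j. rhombus_concave n H \<Longrightarrow> (\<And>r. Suc r < m \<Longrightarrow> s r < s (Suc r)) \<Longrightarrow>
    T \<subseteq> {..<n - t} \<Longrightarrow> s ` {..<m} \<subseteq> T \<Longrightarrow> card T = m + j \<Longrightarrow> (\<And>q. q < m \<Longrightarrow> f q < n) \<Longrightarrow>
    exp ((\<Sum>u\<in>T. slope H t u) / 2) * \<bar>net_minor n (weight H) t m s f\<bar>
      \<le> K * exp ((H (t + m) j - H t 0) / 2)"
    by blast
  let ?K = "real (Suc m) * (real n ^ m * (real n ^ n * K))"
  show ?case
  proof (intro exI[of _ ?K] conjI allI impI)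
    show "?K > 0" using n K(1) by simp
    fix H t s f T j
    assume H: "rhombus_concave n H" and s: "\<forall>r. Suc r < Suc m \<longrightarrow> s r < s (Suc r)"
      and T: "T \<subseteq> {..<n - t}" "s ` {..<Suc m} \<subseteq> T" "card T = Suc m + j" and f: "\<forall>q<Suc m. f q < n"
    define c where "c = weight H"
    have c: "c t s > 0" for t s unfolding c_def weight_def by simp
    have cmono: "c (Suc t) s \<le> c t s" if "t + s + 2 \<le> n" for t s
      using drift_Suc_le[OF H that] unfolding c_def weight_def by simp
    have sm: "s m < n - t" using T by auto
    let ?E = "exp ((\<Sum>u\<in>T. slope H t u) / 2)" and ?R = "exp ((H (t + Suc m) j - H t 0) / 2)"
    let ?\<Phi> = "\<Pi>\<^sub>E r\<in>{..<m}. {s r..<s (Suc r)}"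
    define minor where "minor q \<phi> = net_minor n c (Suc t) m \<phi> (\<lambda>j. f (if j < q then j else Suc j))" for q \<phi>
    have one: "?E * (c t (s m) * ((\<Prod>r<m. c t (s r) / c t (\<phi> r)) * \<bar>minor q \<phi>\<bar>)) \<le> K * ?R"
      if \<phi>: "\<phi> \<in> ?\<Phi>" and q: "q \<le> m" for \<phi> q
    proof -
      have \<phi>r: "s r \<le> \<phi> r \<and> \<phi> r < s (Suc r)" if "r < m" for r
        using PiE_mem[OF \<phi>, of r] that by auto
      obtain T' where T': "T' \<subseteq> {..<n - t - 1}" "\<phi> ` {..<m} \<subseteq> T'" "card T = Suc (card T')"
        "(\<Sum>u\<in>T. slope H t u) + (\<Sum>r\<le>m. drift H t (s r)) - (\<Sum>r<m. drift H t (\<phi> r))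
          \<le> H (Suc t) 0 - H t 0 + (\<Sum>u\<in>T'. slope H (Suc t) u)"
        using advance[OF H T(1) order_refl, of s m \<phi>] T(2) \<phi>r by (auto simp: lessThan_Suc_atMost)
      have IH: "exp ((\<Sum>u\<in>T'. slope H (Suc t) u) / 2) * \<bar>minor q \<phi>\<bar>
        \<le> K * exp ((H (Suc t + m) j - H (Suc t) 0) / 2)"
        unfolding minor_def c_def
      proof (rule K(2)[OF H])
        show "\<phi> r < \<phi> (Suc r)" if "Suc r < m" for r
          using \<phi>r[of r] \<phi>r[of "Suc r"] that by linarith
      qed (use T T' f q in auto)
      have "?E * (c t (s m) * (\<Prod>r<m. c t (s r) / c t (\<phi> r))) =
        exp (((\<Sum>u\<in>T. slope H t u) + (\<Sum>r\<le>m. drift H t (s r)) - (\<Sum>r<m. drift H t (\<phi> r))) / 2)"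
        unfolding c_def weight_def
        by (simp add: exp_diff[symmetric] exp_sum[symmetric] exp_add[symmetric] sum_divide_distrib[symmetric]
            sum_subtractf lessThan_Suc_atMost[symmetric] diff_divide_distrib[symmetric] add_divide_distrib[symmetric])
      also have "\<dots> \<le> exp ((H (Suc t) 0 - H t 0) / 2) * exp ((\<Sum>u\<in>T'. slope H (Suc t) u) / 2)"
        using T'(4) by (simp add: exp_add[symmetric] add_divide_distrib[symmetric])
      finally have "?E * (c t (s m) * (\<Prod>r<m. c t (s r) / c t (\<phi> r))) * \<bar>minor q \<phi>\<bar> \<le>
        exp ((H (Suc t) 0 - H t 0) / 2) * (exp ((\<Sum>u\<in>T'. slope H (Suc t) u) / 2) * \<bar>minor q \<phi>\<bar>)"
        by (simp only: mult.assoc[symmetric]) (rule mult_right_mono, auto)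
      also have "\<dots> \<le> exp ((H (Suc t) 0 - H t 0) / 2) * (K * exp ((H (Suc t + m) j - H (Suc t) 0) / 2))"
        by (intro mult_left_mono IH) simp
      also have "\<dots> = K * ?R"
        by (simp add: exp_add[symmetric] add_divide_distrib[symmetric])
      finally show ?thesis by (simp add: mult.assoc)
    qed
    have card: "real (card ?\<Phi>) \<le> real n ^ m"
    proof -
      have "s (Suc r) - s r \<le> n" if "r < m" for r
      proof -
        have "s (Suc r) \<in> T" using T(2) that by auto
        then show ?thesis using T(1) by auto
      qed
      then have "card ?\<Phi> \<le> (\<Prod>r<m. n)"
        by (simp only: card_PiE finite_lessThan card_atLeastLessThan) (rule prod_mono, auto)
      then show ?thesis by (simp flip: of_nat_power)
    qed
    have "\<bar>net_minor n c t (Suc m) s f\<bar> \<le> (\<Sum>q\<le>m. \<Sum>\<phi>\<in>?\<Phi>. \<bar>net n c t (s m) (f q)\<bar> *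
        ((\<Prod>r<m. c t (s r) / c t (\<phi> r)) * \<bar>minor q \<phi>\<bar>))"
    proof -
      have "\<bar>net_minor n c t (Suc m) s f\<bar> \<le> (\<Sum>q\<le>m. \<bar>net n c t (s m) (f q)\<bar> *
        \<bar>\<Sum>\<phi>\<in>?\<Phi>. (\<Prod>r<m. c t (s r) / c t (\<phi> r)) * minor q \<phi>\<bar>)"
        unfolding minor_def
        by (subst net_minor_Suc[OF c]) (use s sm in \<open>auto simp: abs_mult power_abs intro!: order_trans[OF sum_abs]\<close>)
      also have "\<dots> \<le> (\<Sum>q\<le>m. \<bar>net n c t (s m) (f q)\<bar> *
        (\<Sum>\<phi>\<in>?\<Phi>. (\<Prod>r<m. c t (s r) / c t (\<phi> r)) * \<bar>minor q \<phi>\<bar>))"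
        by (intro sum_mono mult_left_mono order_trans[OF sum_abs])
           (auto simp: abs_mult abs_prod c less_imp_le)
      finally show ?thesis by (simp add: sum_distrib_left)
    qed
    also have "\<dots> \<le> (\<Sum>q\<le>m. \<Sum>\<phi>\<in>?\<Phi>. (real n ^ n * c t (s m)) *
        ((\<Prod>r<m. c t (s r) / c t (\<phi> r)) * \<bar>minor q \<phi>\<bar>))"
    proof (intro sum_mono mult_right_mono)
      fix q assume q: "q \<in> {..m}"
      have "\<bar>net n c t (s m) (f q)\<bar> \<le> real n ^ (f q - t) * c t (s m)"
        by (rule net_bound) (use c cmono sm in auto)
      also have "\<dots> \<le> real n ^ n * c t (s m)"
      proof (intro mult_right_mono power_increasing)
        have "f q < n" using f q by auto
        then show "f q - t \<le> n" by simp
      qed (use n c[of t "s m"] in auto)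
      finally show "\<bar>net n c t (s m) (f q)\<bar> \<le> real n ^ n * c t (s m)" .
    qed (intro mult_nonneg_nonneg prod_nonneg abs_ge_zero divide_nonneg_nonneg less_imp_le[OF c])
    finally have "?E * \<bar>net_minor n c t (Suc m) s f\<bar> \<le> ?E * (\<Sum>q\<le>m. \<Sum>\<phi>\<in>?\<Phi>. (real n ^ n * c t (s m)) *
        ((\<Prod>r<m. c t (s r) / c t (\<phi> r)) * \<bar>minor q \<phi>\<bar>))"
      by (intro mult_left_mono) auto
    also have "\<dots> = (\<Sum>q\<le>m. \<Sum>\<phi>\<in>?\<Phi>. real n ^ n * (?E * (c t (s m) *
        ((\<Prod>r<m. c t (s r) / c t (\<phi> r)) * \<bar>minor q \<phi>\<bar>))))"
      by (simp only: sum_distrib_left mult_ac)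
    also have "\<dots> \<le> (\<Sum>q\<le>m. \<Sum>\<phi>\<in>?\<Phi>. real n ^ n * (K * ?R))"
      by (intro sum_mono mult_left_mono one) auto
    also have "\<dots> = real (Suc m) * (real (card ?\<Phi>) * (real n ^ n * (K * ?R)))"
      by simp
    also have "\<dots> \<le> real (Suc m) * (real n ^ m * (real n ^ n * (K * ?R)))"
      using card K(1) by (intro mult_left_mono mult_right_mono) auto
    finally show "?E * \<bar>net_minor n (weight H) t (Suc m) s f\<bar> \<le> ?K * ?R"
      unfolding c_def by (simp add: mult_ac)
  qed
qed

text \<open>
  The drifts along an antidiagonal \<open>t + s = const\<close> telescope.
\<close>

lemma net_minor_leading_weight:
  assumes "i + j \<le> n"
  shows "(net_minor n (weight H) 0 i (\<lambda>r. j + r) (\<lambda>q. q))\<^sup>2 = exp (H i j - H 0 (i + j))"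
proof -
  have "\<bar>net_minor n (weight H) 0 i (\<lambda>r. j + r) (\<lambda>q. 0 + q)\<bar> = (\<Prod>q<i. weight H (0 + q) (j + i - Suc q))"
    using assms by (intro net_minor_leading) (auto simp: weight_def)
  then have "\<bar>net_minor n (weight H) 0 i (\<lambda>r. j + r) (\<lambda>q. q)\<bar> = (\<Prod>q<i. weight H q (j + i - Suc q))"
    by (simp only: add_0)
  then have "(net_minor n (weight H) 0 i (\<lambda>r. j + r) (\<lambda>q. q))\<^sup>2 = (\<Prod>q<i. weight H q (j + i - Suc q))\<^sup>2"
    by (subst power2_abs[symmetric]) (simp only:)
  also have "\<dots> = (\<Prod>q<i. exp (drift H q (j + i - Suc q)))"
    by (simp add: weight_def power2_eq_square prod.distrib[symmetric] exp_add[symmetric])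
  also have "\<dots> = exp (\<Sum>q<i. H (Suc q) (j + i - Suc q) - H q (j + i - q))"
    by (auto simp: exp_sum drift_def Suc_diff_Suc intro!: prod.cong)
  also have "(\<Sum>q<i. H (Suc q) (j + i - Suc q) - H q (j + i - q)) = H i j - H 0 (i + j)"
    by (subst sum_lessThan_telescope) (simp add: add.commute)
  finally show ?thesis .
qed

section \<open>Coefficients of the determinant of a pencil\<close>

definition unit3 :: "nat \<Rightarrow> triple" where
  "unit3 l = (if l = 0 then (1, 0, 0) else if l = 1 then (0, 1, 0) else (0, 0, 1))"

text \<open>
  A word chooses one of the three matrices in each row; the letters \<open>0\<close>, \<open>1\<close>, \<open>2\<close> stand for \<open>x\<close>,
  \<open>y\<close>, \<open>z\<close>.
\<close>

definition words :: "nat \<Rightarrow> (nat \<Rightarrow> nat) set" where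
  "words n = (\<Pi>\<^sub>E r\<in>{..<n}. {..<3})"

definition word_content :: "nat \<Rightarrow> (nat \<Rightarrow> nat) \<Rightarrow> triple" where
  "word_content n \<phi> = (\<Sum>r<n. unit3 (\<phi> r))"

definition select3 :: "'a \<Rightarrow> 'a \<Rightarrow> 'a \<Rightarrow> nat \<Rightarrow> 'a" where
  "select3 X Y Z l = (if l = 0 then X else if l = 1 then Y else Z)"

definition mixed_det :: "nat \<Rightarrow> 'a mat \<Rightarrow> 'a mat \<Rightarrow> 'a::comm_ring_1 mat \<Rightarrow> (nat \<Rightarrow> nat) \<Rightarrow> 'a" where
  "mixed_det n X Y Z \<phi> = det (mat n n (\<lambda>(r, c). select3 X Y Z (\<phi> r) $$ (r, c)))"

definition monomial3 :: "'a::comm_ring_1 \<Rightarrow> 'a \<Rightarrow> 'a \<Rightarrow> triple \<Rightarrow> 'a" where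
  "monomial3 x y z = (\<lambda>(i, j, k). x ^ i * y ^ j * z ^ k)"

lemma finite_Delta [simp]: "finite (Delta n)"
  by (rule finite_subset[of _ "{..n} \<times> {..n} \<times> {..n}"]) (auto simp: Delta_def)

lemma finite_words [simp]: "finite (words n)"
  unfolding words_def by (intro finite_PiE) auto

lemma word_content_eq:
  assumes "\<phi> \<in> words n"
  shows "word_content n \<phi> = (card {r. r < n \<and> \<phi> r = 0}, card {r. r < n \<and> \<phi> r = 1}, card {r. r < n \<and> \<phi> r = 2})"
proof -
  have lt: "\<phi> r < 3" if "r < n" for r using assms that by (auto simp: words_def)
  have "m \<le> n \<Longrightarrow> word_content m \<phi> = (card {r. r < m \<and> \<phi> r = 0}, card {r. r < m \<and> \<phi> r = 1}, card {r. r < m \<and> \<phi> r = 2})" for m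
  proof (induction m)
    case 0
    then show ?case by (simp add: word_content_def zero_prod_def)
  next
    case (Suc m)
    have split: "{r. r < Suc m \<and> \<phi> r = l} = (if \<phi> m = l then insert m {r. r < m \<and> \<phi> r = l} else {r. r < m \<and> \<phi> r = l})" for l
      by (auto simp: less_Suc_eq)
    consider "\<phi> m = 0" | "\<phi> m = 1" | "\<phi> m = 2" using lt[of m] Suc.prems by linarith
    then show ?case
      using Suc by cases (simp_all add: word_content_def split unit3_def)
  qed
  then show ?thesis by simp
qed

lemma word_content_in_Delta:
  assumes "\<phi> \<in> words n"
  shows "word_content n \<phi> \<in> Delta n"
proof -
  have "{r. r < n \<and> \<phi> r = 0} \<union> {r. r < n \<and> \<phi> r = 1} \<union> {r. r < n \<and> \<phi> r = 2} = {..<n}"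
    using assms by (fastforce simp: words_def PiE_def Pi_def)
  then have "n = card ({r. r < n \<and> \<phi> r = 0} \<union> {r. r < n \<and> \<phi> r = 1} \<union> {r. r < n \<and> \<phi> r = 2})" by simp
  also have "\<dots> = card {r. r < n \<and> \<phi> r = 0} + card {r. r < n \<and> \<phi> r = 1} + card {r. r < n \<and> \<phi> r = 2}"
    by (subst card_Un_disjoint; (subst card_Un_disjoint)?) auto
  finally show ?thesis using word_content_eq[OF assms] by (simp add: Delta_def)
qed

lemma prod_single:
  "(\<Prod>i<(m::nat). Poly_Mapping.single (d i) (x i :: 'a::comm_ring_1)) = Poly_Mapping.single (\<Sum>i<m. d i :: triple) (\<Prod>i<m. x i)"
  by (induction m) (simp_all add: mult_single)

lemma det_single:
  fixes f :: "nat \<Rightarrow> nat \<Rightarrow> 'a::comm_ring_1" and d :: "nat \<Rightarrow> triple"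
  shows "det (mat m m (\<lambda>(i, j). Poly_Mapping.single (d i) (f i j))) =
    Poly_Mapping.single (\<Sum>i<m. d i) (det (mat m m (\<lambda>(i, j). f i j)))"
proof -
  have sgn: "of_int (sign p) * Poly_Mapping.single D x = Poly_Mapping.single D (of_int (sign p) * x)"
    for p :: "nat \<Rightarrow> nat" and D :: triple and x :: 'a
    by (cases p rule: sign_cases) (simp_all add: single_uminus)
  have sums: "(\<Sum>p\<in>P. Poly_Mapping.single D (x p)) = Poly_Mapping.single D (\<Sum>p\<in>P. x p)"
    for P :: "(nat \<Rightarrow> nat) set" and D :: triple and x :: "_ \<Rightarrow> 'a"
    by (induction P rule: infinite_finite_induct) (simp_all add: single_add)
  show ?thesis
    unfolding det_mat_permutations prod_single sgn sums ..
qed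

lemma lookup_sum_single:
  "Poly_Mapping.lookup (\<Sum>\<phi>\<in>W. Poly_Mapping.single (c \<phi>) (x \<phi>)) d = (\<Sum>\<phi>\<in>W. if c \<phi> = d then x \<phi> else 0)"
  by (induction W rule: infinite_finite_induct) (auto simp: Poly_Mapping.lookup_add Poly_Mapping.lookup_single when_def)

text \<open>
  Multilinearity in the rows: a word contributes to the monomial given by the numbers of its
  letters, and its contribution does not involve the variables.
\<close>

lemma lookup_det_pencil:
  assumes "X \<in> carrier_mat n n" "Y \<in> carrier_mat n n" "Z \<in> carrier_mat n n"
  shows "Poly_Mapping.lookup (det (pencil X Y Z)) d = (\<Sum>\<phi> | \<phi> \<in> words n \<and> word_content n \<phi> = d. mixed_det n X Y Z \<phi>)"
proof -
  have "pencil X Y Z = mat n n (\<lambda>(r, c). \<Sum>l<3. Poly_Mapping.single (unit3 l) (select3 X Y Z l $$ (r, c)))"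
    using assms by (intro eq_matI)
      (auto simp: pencil_def var_x_def var_y_def var_z_def const3_def mult_single select3_def unit3_def
        numeral_3_eq_3)
  then have "det (pencil X Y Z) = (\<Sum>\<phi>\<in>words n. Poly_Mapping.single (word_content n \<phi>) (mixed_det n X Y Z \<phi>))"
    unfolding words_def word_content_def mixed_det_def by (simp add: det_mat_sum det_single)
  then have "Poly_Mapping.lookup (det (pencil X Y Z)) d = (\<Sum>\<phi>\<in>words n. if word_content n \<phi> = d then mixed_det n X Y Z \<phi> else 0)"
    by (simp add: lookup_sum_single)
  then show ?thesis by (simp add: sum.If_cases Int_def)
qed

lemma det_pencil_eval:
  fixes X Y Z :: "complex mat"
  assumes "X \<in> carrier_mat n n" "Y \<in> carrier_mat n n" "Z \<in> carrier_mat n n"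
  shows "det (x \<cdot>\<^sub>m X + y \<cdot>\<^sub>m Y + z \<cdot>\<^sub>m Z) = (\<Sum>d\<in>Delta n. Poly_Mapping.lookup (det (pencil X Y Z)) d * monomial3 x y z d)"
proof -
  have monomial: "(\<Prod>r<m. select3 x y z (\<phi> r)) = monomial3 x y z (word_content m \<phi>)" for m \<phi>
    by (induction m) (auto simp: word_content_def monomial3_def select3_def unit3_def zero_prod_def split: prod.splits)
  have "x \<cdot>\<^sub>m X + y \<cdot>\<^sub>m Y + z \<cdot>\<^sub>m Z =
      mat n n (\<lambda>(r, c). \<Sum>l<3. select3 x y z l * select3 X Y Z l $$ (r, c))"
    using assms by (intro eq_matI) (auto simp: select3_def numeral_3_eq_3)
  then have "det (x \<cdot>\<^sub>m X + y \<cdot>\<^sub>m Y + z \<cdot>\<^sub>m Z) =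
      (\<Sum>\<phi>\<in>words n. monomial3 x y z (word_content n \<phi>) * mixed_det n X Y Z \<phi>)"
    unfolding words_def mixed_det_def by (simp add: det_mat_sum det_mat_scale_rows monomial)
  also have "\<dots> = (\<Sum>d\<in>Delta n. \<Sum>\<phi> | \<phi> \<in> words n \<and> word_content n \<phi> = d. monomial3 x y z (word_content n \<phi>) * mixed_det n X Y Z \<phi>)"
    by (rule sum.group[symmetric]) (auto simp: word_content_in_Delta)
  also have "\<dots> = (\<Sum>d\<in>Delta n. Poly_Mapping.lookup (det (pencil X Y Z)) d * monomial3 x y z d)"
    unfolding lookup_det_pencil[OF assms] by (auto simp: sum_distrib_left mult_ac intro!: sum.cong)
  finally show ?thesis .
qed

section \<open>Polynomials without zeros in a half-plane\<close>

text \<open>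
  Dividing by factorials turns differentiation into a shift of the coefficient array.
\<close>

definition eval3 :: "nat \<Rightarrow> (triple \<Rightarrow> real) \<Rightarrow> complex \<Rightarrow> complex \<Rightarrow> complex \<Rightarrow> complex" where
  "eval3 m a x y z = (\<Sum>(i, j, k)\<in>Delta m. of_real (a (i, j, k)) * (x ^ i / fact i) * (y ^ j / fact j) * (z ^ k / fact k))"

text \<open>
  The point \<open>0\<close> is admitted to every half-plane. This excludes zeros on the faces \<open>z = 0\<close> and on the
  axes as well, which yields information on the coefficients at the boundary of the triangle.
\<close>

definition in_half_plane :: "complex \<Rightarrow> complex \<Rightarrow> bool" where
  "in_half_plane u w \<longleftrightarrow> w = 0 \<or> Re (u * w) > 0"

definition half_plane_stable :: "nat \<Rightarrow> (triple \<Rightarrow> real) \<Rightarrow> bool" where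
  "half_plane_stable m a \<longleftrightarrow> (\<forall>u x y z. in_half_plane u x \<longrightarrow> in_half_plane u y \<longrightarrow> in_half_plane u z \<longrightarrow>
     \<not> (x = 0 \<and> y = 0 \<and> z = 0) \<longrightarrow> eval3 m a x y z \<noteq> 0)"

definition shift_x :: "(triple \<Rightarrow> real) \<Rightarrow> triple \<Rightarrow> real" where
  "shift_x a = (\<lambda>(i, j, k). a (Suc i, j, k))"

text \<open>
  The cyclic permutation of the variables reduces statements on all three directions to one.
\<close>

definition rot :: "(triple \<Rightarrow> real) \<Rightarrow> triple \<Rightarrow> real" where
  "rot a = (\<lambda>(i, j, k). a (k, i, j))"

lemma rot_apply [simp]: "rot a (i, j, k) = a (k, i, j)" by (simp add: rot_def)
lemma shift_x_apply [simp]: "shift_x a (i, j, k) = a (Suc i, j, k)" by (simp add: shift_x_def)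

lemma eval3_rot: "eval3 m (rot a) x y z = eval3 m a z x y"
  unfolding eval3_def
  by (rule sum.reindex_bij_witness[of _ "\<lambda>(k, i, j). (i, j, k)" "\<lambda>(i, j, k). (k, i, j)"])
     (auto simp: Delta_def mult_ac)

lemma half_plane_stable_rot [simp]: "half_plane_stable m (rot a) \<longleftrightarrow> half_plane_stable m a"
  unfolding half_plane_stable_def eval3_rot by blast

lemma eval3_x: "eval3 m a x 0 0 = of_real (a (m, 0, 0)) * x ^ m / fact m"
proof -
  have "eval3 m a x 0 0 = (\<Sum>(i, j, k)\<in>{(m, 0, 0)}. of_real (a (i, j, k)) * (x ^ i / fact i) * (0 ^ j / fact j) * (0 ^ k / fact k))"
    unfolding eval3_def
    by (rule sum.mono_neutral_right[OF finite_Delta]) (auto simp: Delta_def power_0_left split: if_splits)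
  then show ?thesis by simp
qed

lemma eval3_y: "eval3 m a 0 y 0 = of_real (a (0, m, 0)) * y ^ m / fact m"
  using eval3_x[of m "rot a" y] by (simp add: eval3_rot)

lemma eval3_z: "eval3 m a 0 0 z = of_real (a (0, 0, m)) * z ^ m / fact m"
  using eval3_x[of m "rot (rot a)" z] by (simp add: eval3_rot)

definition poly_in_x :: "nat \<Rightarrow> (triple \<Rightarrow> real) \<Rightarrow> complex \<Rightarrow> complex \<Rightarrow> complex poly" where
  "poly_in_x m a y z = (\<Sum>(i, j, k)\<in>Delta m.
     monom (of_real (a (i, j, k)) / fact i * (y ^ j / fact j) * (z ^ k / fact k)) i)"

lemma poly_poly_in_x: "poly (poly_in_x m a y z) x = eval3 m a x y z"
  unfolding poly_in_x_def eval3_def by (auto simp: poly_sum poly_monom intro!: sum.cong)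

lemma coeff_poly_in_x: "coeff (poly_in_x m a y z) m = of_real (a (m, 0, 0)) / fact m"
proof -
  have "coeff (poly_in_x m a y z) m = (\<Sum>(i, j, k)\<in>{(m, 0, 0)}.
     if i = m then (of_real (a (i, j, k)) / fact i * (y ^ j / fact j) * (z ^ k / fact k)) else 0)"
    unfolding poly_in_x_def coeff_sum
    by (rule sum.mono_neutral_cong_right[OF finite_Delta]) (auto simp: Delta_def split: if_splits)
  then show ?thesis by simp
qed

lemma pderiv_poly_in_x: "pderiv (poly_in_x (Suc m) a y z) = poly_in_x m (shift_x a) y z"
proof -
  have "pderiv (poly_in_x (Suc m) a y z) = (\<Sum>(i, j, k)\<in>Delta (Suc m).
     monom (of_nat i * (of_real (a (i, j, k)) / fact i * (y ^ j / fact j) * (z ^ k / fact k))) (i - 1))"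
    unfolding poly_in_x_def pderiv_sum
    by (auto simp: pderiv_monom intro!: sum.cong)
  also have "\<dots> = (\<Sum>(i, j, k)\<in>{(i, j, k). i \<noteq> 0 \<and> i + j + k = Suc m}.
     monom (of_nat i * (of_real (a (i, j, k)) / fact i * (y ^ j / fact j) * (z ^ k / fact k))) (i - 1))"
    by (rule sum.mono_neutral_right) (auto simp: Delta_def intro: finite_subset[OF _ finite_Delta[of "Suc m"]])
  also have "\<dots> = poly_in_x m (shift_x a) y z"
    unfolding poly_in_x_def
    by (rule sum.reindex_bij_witness[of _ "\<lambda>(i, j, k). (Suc i, j, k)" "\<lambda>(i, j, k). (i - 1, j, k)"])
       (auto simp: Delta_def gr0_conv_Suc fact_Suc divide_simps simp del: of_nat_Suc)
  finally show ?thesis .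
qed

text \<open>
  Gauss-Lucas: the logarithmic derivative is the sum of \<open>1 / (x - r)\<close> over the roots \<open>r\<close>, and all
  of these lie in one half-plane when the \<open>x - r\<close> do.
\<close>

lemma log_derivative_half_plane:
  fixes p :: "complex poly"
  assumes "p \<noteq> 0" "\<And>r. poly p r = 0 \<Longrightarrow> Re (u * (x - r)) > 0" "degree p > 0"
  shows "Re (cnj u * (poly (pderiv p) x / poly p x)) > 0"
  using assms
proof (induction "degree p" arbitrary: p)
  case 0
  then show ?case by simp
next
  case (Suc d)
  have "\<not> constant (poly p)" using Suc.prems(3) by (simp add: constant_degree)
  then obtain r where r: "poly p r = 0" using fundamental_theorem_of_algebra by blast
  then obtain q where q: "p = [:- r, 1:] * q" by (metis dvdE poly_eq_0_iff_dvd)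
  have q0: "q \<noteq> 0" using q Suc.prems(1) by auto
  then have "degree p = degree [:- r, 1:] + degree q" unfolding q by (intro degree_mult_eq) auto
  then have deg: "degree q = d" using Suc.hyps(2) by simp
  have root: "Re (u * (x - s)) > 0" if "poly q s = 0" for s
    using Suc.prems(2)[of s] that by (simp add: q)
  have qx: "poly q x \<noteq> 0" using root[of x] by auto
  have rx: "Re (u * (x - r)) > 0" by (rule Suc.prems(2)[OF r])
  then have xr: "x - r \<noteq> 0" by auto
  have "poly (pderiv p) x / poly p x = 1 / (x - r) + poly (pderiv q) x / poly q x"
  proof -
    have "pderiv p = [:- r, 1:] * pderiv q + q"
      unfolding q by (subst pderiv_mult) (simp add: pderiv_pCons)
    then have "poly (pderiv p) x = poly ([:- r, 1:] * pderiv q + q) x" by (simp only:)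
    also have "\<dots> = (x - r) * poly (pderiv q) x + poly q x" by (simp add: algebra_simps)
    finally have "poly (pderiv p) x = (x - r) * poly (pderiv q) x + poly q x" .
    moreover have "poly p x = (x - r) * poly q x" by (simp add: q algebra_simps)
    ultimately show ?thesis using qx xr by (simp add: divide_simps)
  qed
  moreover have "Re (cnj u * (1 / (x - r))) > 0"
  proof -
    have "cnj u * (1 / (x - r)) = cnj (u * (x - r)) / of_real ((cmod (x - r))\<^sup>2)"
      by (subst complex_div_cnj) simp
    then have "Re (cnj u * (1 / (x - r))) = Re (u * (x - r)) / (cmod (x - r))\<^sup>2"
      by (simp only: Re_divide_of_real cnj.sel)
    also have "\<dots> > 0" using rx xr by (intro divide_pos_pos) simp_all
    finally show ?thesis .
  qed
  moreover have "Re (cnj u * (poly (pderiv q) x / poly q x)) \<ge> 0"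
  proof (cases "d = 0")
    case True
    then have "pderiv q = 0" using deg by (simp add: pderiv_eq_0_iff)
    then show ?thesis by simp
  next
    case False
    then show ?thesis using Suc.hyps(1)[of q] deg q0 root by fastforce
  qed
  ultimately show ?case by (simp add: distrib_left)
qed

lemma half_plane_perturb:
  assumes "in_half_plane u y"
  shows "\<exists>\<delta>>0. \<forall>\<epsilon>. 0 < \<epsilon> \<and> \<epsilon> \<le> \<delta> \<longrightarrow> in_half_plane (u + of_real \<epsilon> * w) y"
proof (cases "y = 0")
  case True
  then show ?thesis by (intro exI[of _ 1]) (auto simp: in_half_plane_def)
next
  case False
  then have A: "Re (u * y) > 0" using assms by (simp add: in_half_plane_def)
  let ?B = "\<bar>Re (w * y)\<bar> + 1"
  have B: "2 * ?B > 0" by (intro mult_pos_pos add_nonneg_pos) simp_all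
  let ?\<delta> = "Re (u * y) / (2 * ?B)"
  have "in_half_plane (u + of_real \<epsilon> * w) y" if \<epsilon>: "0 < \<epsilon>" "\<epsilon> \<le> ?\<delta>" for \<epsilon>
  proof -
    have "\<epsilon> * \<bar>Re (w * y)\<bar> \<le> \<epsilon> * ?B" using \<epsilon> by (intro mult_left_mono) auto
    also have "\<dots> \<le> Re (u * y) / 2"
    proof -
      have "\<epsilon> * (2 * ?B) \<le> Re (u * y)" by (rule iffD1[OF pos_le_divide_eq[OF B] \<epsilon>(2)])
      then show ?thesis by linarith
    qed
    finally have "\<bar>\<epsilon> * Re (w * y)\<bar> \<le> Re (u * y) / 2" using \<epsilon> by (simp add: abs_mult)
    moreover have "Re ((u + of_real \<epsilon> * w) * y) = Re (u * y) + \<epsilon> * Re (w * y)"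
      by (simp add: algebra_simps)
    ultimately have "Re ((u + of_real \<epsilon> * w) * y) > 0" using A by linarith
    then show ?thesis by (simp add: in_half_plane_def)
  qed
  moreover have "?\<delta> > 0" by (rule divide_pos_pos[OF A B])
  ultimately show ?thesis by blast
qed

text \<open>
  By stability no root in the variable \<open>x\<close> lies in the half-plane. The point \<open>x\<close> itself may be
  \<open>0\<close>, so it is necessary to exclude roots on the boundary line, too.
\<close>

lemma stable_log_derivative:
  assumes st: "half_plane_stable (Suc m) a"
    and hp: "in_half_plane u x" "in_half_plane u y" "in_half_plane u z" and yz: "\<not> (y = 0 \<and> z = 0)"
  shows "Re (cnj u * (eval3 m (shift_x a) x y z / eval3 (Suc m) a x y z)) > 0"
proof -
  let ?p = "poly_in_x (Suc m) a y z"
  have "eval3 (Suc m) a 1 0 0 \<noteq> 0"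
    using st[unfolded half_plane_stable_def, rule_format, of 1 1 0 0] by (simp add: in_half_plane_def)
  then have lead: "coeff ?p (Suc m) \<noteq> 0" unfolding coeff_poly_in_x by (simp add: eval3_x)
  then have p0: "?p \<noteq> 0" and deg: "degree ?p > 0"
    using le_degree[OF lead] by auto
  have "Re (u * r) < 0" if r: "poly ?p r = 0" for r
  proof (rule ccontr)
    assume ge: "\<not> Re (u * r) < 0"
    have ev0: "eval3 (Suc m) a r y z = 0" using r by (simp add: poly_poly_in_x)
    have "\<not> in_half_plane u r"
      using st ev0 hp(2,3) yz unfolding half_plane_stable_def by blast
    then have r0: "r \<noteq> 0" "Re (u * r) = 0" using ge by (auto simp: in_half_plane_def)
    obtain \<delta>1 where \<delta>1: "\<delta>1 > 0" "\<And>\<epsilon>. 0 < \<epsilon> \<Longrightarrow> \<epsilon> \<le> \<delta>1 \<Longrightarrow> in_half_plane (u + of_real \<epsilon> * cnj r) y"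
      using half_plane_perturb[OF hp(2)] by blast
    obtain \<delta>2 where \<delta>2: "\<delta>2 > 0" "\<And>\<epsilon>. 0 < \<epsilon> \<Longrightarrow> \<epsilon> \<le> \<delta>2 \<Longrightarrow> in_half_plane (u + of_real \<epsilon> * cnj r) z"
      using half_plane_perturb[OF hp(3)] by blast
    (* A root on the boundary line is inside a slightly tilted half-plane that still contains
       y and z. *)
    define \<epsilon> where "\<epsilon> = min \<delta>1 \<delta>2"
    have \<epsilon>: "\<epsilon> > 0" "\<epsilon> \<le> \<delta>1" "\<epsilon> \<le> \<delta>2" using \<delta>1(1) \<delta>2(1) by (auto simp: \<epsilon>_def)
    have "(cmod r)\<^sup>2 = Re r * Re r + Im r * Im r" by (simp only: cmod_power2) (simp add: power2_eq_square)
    then have "Re ((u + of_real \<epsilon> * cnj r) * r) = Re (u * r) + \<epsilon> * (cmod r)\<^sup>2"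
      by (simp only:) (simp add: algebra_simps)
    then have "in_half_plane (u + of_real \<epsilon> * cnj r) r"
      using r0 \<epsilon>(1) by (simp add: in_half_plane_def)
    then show False
      using st ev0 \<delta>1(2)[OF \<epsilon>(1,2)] \<delta>2(2)[OF \<epsilon>(1,3)] yz unfolding half_plane_stable_def by blast
  qed
  moreover have "Re (u * x) \<ge> 0" using hp(1) by (auto simp: in_half_plane_def)
  ultimately have "Re (u * (x - r)) > 0" if "poly ?p r = 0" for r
    using that by (fastforce simp: right_diff_distrib)
  from log_derivative_half_plane[OF p0 this deg] show ?thesis
    by (simp add: pderiv_poly_in_x poly_poly_in_x)
qed

lemma half_plane_stable_shift_x:
  assumes st: "half_plane_stable (Suc m) a"
  shows "half_plane_stable m (shift_x a)"
  unfolding half_plane_stable_def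
proof (intro allI impI)
  fix u x y z
  assume hp: "in_half_plane u x" "in_half_plane u y" "in_half_plane u z" and nz: "\<not> (x = 0 \<and> y = 0 \<and> z = 0)"
  show "eval3 m (shift_x a) x y z \<noteq> 0"
  proof (cases "y = 0 \<and> z = 0")
    case True
    have "eval3 (Suc m) a 1 0 0 \<noteq> 0"
      using st[unfolded half_plane_stable_def, rule_format, of 1 1 0 0] by (simp add: in_half_plane_def)
    then show ?thesis using True nz by (simp add: eval3_x)
  next
    case False
    then show ?thesis using stable_log_derivative[OF st hp] by force
  qed
qed

text \<open>
  Iterated differentiation in all three variables.
\<close>

lemma half_plane_stable_shift:
  assumes "half_plane_stable (m + i + j + k) a"
  shows "half_plane_stable m (\<lambda>(p, q, r). a (p + i, q + j, r + k))"
proof -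
  have step: "half_plane_stable (m + i) a \<Longrightarrow> half_plane_stable m (\<lambda>(p, q, r). a (p + i, q, r))" for m i a
  proof (induction i arbitrary: a)
    case (Suc i)
    then show ?case
      using Suc.IH[OF half_plane_stable_shift_x, of a] by (simp add: shift_x_def)
  qed (simp add: split_def)
  have "half_plane_stable (m + i + j) (rot (\<lambda>(p, q, r). rot (rot a) (p + k, q, r)))"
    unfolding half_plane_stable_rot by (rule step) (use assms in simp)
  moreover have "rot (\<lambda>(p, q, r). rot (rot a) (p + k, q, r)) = (\<lambda>(p, q, r). a (p, q, r + k))"
    by (auto simp: fun_eq_iff)
  ultimately have "half_plane_stable (m + i + j) (\<lambda>(p, q, r). a (p, q, r + k))" by (simp only:)
  then have "half_plane_stable (m + i) (rot (rot (\<lambda>(p, q, r). rot (\<lambda>(p, q, r). a (p, q, r + k)) (p + j, q, r))))"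
    unfolding half_plane_stable_rot by (intro step) simp
  moreover have "rot (rot (\<lambda>(p, q, r). rot (\<lambda>(p, q, r). a (p, q, r + k)) (p + j, q, r))) = (\<lambda>(p, q, r). a (p, q + j, r + k))"
    by (auto simp: fun_eq_iff)
  ultimately have "half_plane_stable m (\<lambda>(p, q, r). (\<lambda>(p, q, r). a (p, q + j, r + k)) (p + i, q, r))"
    by (intro step) (simp only:)
  then show ?thesis by simp
qed

text \<open>
  At the points \<open>(0, 1, 0)\<close> and \<open>(0, 0, 1)\<close> the logarithmic derivative in \<open>x\<close> is a quotient of two
  coefficients.
\<close>

lemma stable_neighbour_pos:
  assumes "half_plane_stable (Suc m) a" "a (0, Suc m, 0) > 0" "a (0, 0, Suc m) > 0"
  shows "a (1, m, 0) > 0" "a (1, 0, m) > 0"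
proof -
  have pos: "a' > 0" if r: "Re (e / e') > 0" and e: "e = of_real a' / fact m" "e' = of_real b / fact (Suc m)" and b: "b > 0"
    for a' b :: real and e e'
  proof -
    have "e / e' = of_real (a' / fact m / (b / fact (Suc m)))"
      unfolding e by (simp only: of_real_divide of_real_fact)
    then have "0 < a' / fact m / (b / fact (Suc m))" using r by (simp only: Re_complex_of_real)
    moreover have "0 < b / fact (Suc m)" using b by (intro divide_pos_pos) (auto simp del: fact_Suc)
    ultimately have "0 < a' / fact m" by (metis zero_less_divide_iff not_less_iff_gr_or_eq)
    then show ?thesis by (metis zero_less_divide_iff fact_gt_zero not_less_iff_gr_or_eq)
  qed
  show "a (1, m, 0) > 0"
  proof (rule pos[where b = "a (0, Suc m, 0)"])
    show "Re (eval3 m (shift_x a) 0 1 0 / eval3 (Suc m) a 0 1 0) > 0"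
      using stable_log_derivative[OF assms(1), of 1 0 1 0] by (simp add: in_half_plane_def)
  qed (use assms in \<open>simp_all add: eval3_y del: fact_Suc\<close>)
  show "a (1, 0, m) > 0"
  proof (rule pos[where b = "a (0, 0, Suc m)"])
    show "Re (eval3 m (shift_x a) 0 0 1 / eval3 (Suc m) a 0 0 1) > 0"
      using stable_log_derivative[OF assms(1), of 1 0 0 1] by (simp add: in_half_plane_def)
  qed (use assms in \<open>simp_all add: eval3_z del: fact_Suc\<close>)
qed

text \<open>
  The preceding lemma gives positive corners to the derivative in \<open>x\<close>, hence by symmetry to all
  three derivatives, and each coefficient is a coefficient of one of them.
\<close>

lemma stable_coeffs_pos:
  assumes "half_plane_stable m a" "a (m, 0, 0) > 0" "a (0, m, 0) > 0" "a (0, 0, m) > 0" "d \<in> Delta m"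
  shows "a d > 0"
  using assms
proof (induction m arbitrary: a d)
  case 0
  then show ?case by (auto simp: Delta_def)
next
  case (Suc m)
  have x: "a (Suc i, j, k) > 0"
    if "half_plane_stable (Suc m) a" "a (Suc m, 0, 0) > 0" "a (0, Suc m, 0) > 0" "a (0, 0, Suc m) > 0" "i + j + k = m"
    for a i j k
    using Suc.IH[of "shift_x a" "(i, j, k)"] half_plane_stable_shift_x[OF that(1)]
      stable_neighbour_pos[OF that(1,3,4)] that by (simp add: Delta_def)
  obtain i j k where d: "d = (i, j, k)" "i + j + k = Suc m" using Suc.prems(5) by (auto simp: Delta_def)
  consider i' where "i = Suc i'" | j' where "j = Suc j'" | k' where "k = Suc k'"
    using d(2) by (cases i; cases j; cases k) auto
  then show ?case
  proof cases
    case 1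
    then show ?thesis using x[of a i' j k] Suc.prems d by simp
  next
    case 2
    then show ?thesis using x[of "rot a" j' k i] Suc.prems d by simp
  next
    case 3
    then show ?thesis using x[of "rot (rot a)" k' i j] Suc.prems d by simp
  qed
qed

text \<open>
  Write \<open>b\<close> and \<open>c\<close> for the coefficients of \<open>x z\<close> and \<open>y z\<close>. At \<open>x = c\<close>, \<open>y = b\<close> the linear
  coefficient in \<open>z\<close> is \<open>2 b c\<close>, while the constant term is at least \<open>b c\<close> times the coefficient of
  \<open>x y\<close>. As \<open>x\<close> and \<open>y\<close> are positive, stability allows no zero at a nonreal \<open>z\<close>, so the
  discriminant is nonnegative.
\<close>

lemma stable_quadratic:
  assumes st: "half_plane_stable 2 a" and pos: "\<And>d. d \<in> Delta 2 \<Longrightarrow> a d > 0"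
  shows "a (0, 0, 2) * a (1, 1, 0) \<le> 2 * (a (1, 0, 1) * a (0, 1, 1))"
proof -
  define b c where "b = a (1, 0, 1)" and "c = a (0, 1, 1)"
  have bc: "b > 0" "c > 0" unfolding b_def c_def by (auto intro!: pos simp: Delta_def)
  define P where "P = a (0, 0, 2) / 2"
  define R where "R = a (2, 0, 0) * c\<^sup>2 / 2 + a (0, 2, 0) * b\<^sup>2 / 2 + a (1, 1, 0) * b * c"
  have P: "P > 0" unfolding P_def using pos[of "(0, 0, 2)"] by (simp add: Delta_def)
  have Delta2: "Delta 2 = {(2,0,0),(0,2,0),(0,0,2),(1,1,0),(1,0,1),(0,1,1)}"
    unfolding Delta_def by auto
  have ev: "eval3 2 a (of_real c) (of_real b) z = of_real P * z\<^sup>2 + of_real (2 * b * c) * z + of_real R" for z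
    unfolding eval3_def Delta2 P_def R_def by (simp add: b_def c_def)
  have "P * R \<le> (b * c)\<^sup>2"
  proof (rule ccontr)
    assume "\<not> P * R \<le> (b * c)\<^sup>2"
    then have D: "P * R - (b * c)\<^sup>2 > 0" by simp
    define s where "s = sqrt (P * R - (b * c)\<^sup>2)"
    have s: "s > 0" "s\<^sup>2 = P * R - (b * c)\<^sup>2" using D by (auto simp: s_def)
    define z where "z = Complex (- (b * c) / P) (s / P)"
    have "of_real P * z\<^sup>2 + of_real (2 * b * c) * z + of_real R = 0"
    proof -
      have "P * ((b * c / P)\<^sup>2 - (s / P)\<^sup>2) - 2 * b * c * (b * c / P) + R = 0"
      proof -
        have R: "R = (s\<^sup>2 + (b * c)\<^sup>2) / P" using P s(2) by (simp add: field_simps)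
        show ?thesis unfolding R using P by (simp add: power2_eq_square field_simps)
      qed
      moreover have "P * (2 * (- (b * c) / P) * (s / P)) + 2 * b * c * (s / P) = 0"
        using P by (simp add: field_simps)
      ultimately show ?thesis
        by (simp add: complex_eq_iff z_def power2_eq_square)
    qed
    then have "eval3 2 a (of_real c) (of_real b) z = 0" by (simp add: ev)
    moreover obtain u where "Re u > 0" "Re (u * z) > 0"
    proof -
      have "\<exists>u. Re u > 0 \<and> Re (u * z) > 0"
        using P s(1) by (intro exI[of _ "Complex 1 (- (b * c + 1) / s)"]) (simp add: z_def field_simps)
      then show ?thesis using that by blast
    qed
    moreover have "in_half_plane u (of_real c)" "in_half_plane u (of_real b)" "in_half_plane u z"
      using \<open>Re u > 0\<close> \<open>Re (u * z) > 0\<close> bc unfolding in_half_plane_def by simp_all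
    ultimately show False
      using st[unfolded half_plane_stable_def, rule_format, of u "of_real c" "of_real b" z] bc by simp
  qed
  moreover have "P * (a (1, 1, 0) * (b * c)) \<le> P * R"
    unfolding R_def using P pos[of "(2, 0, 0)"] pos[of "(0, 2, 0)"]
    by (intro mult_left_mono) (auto simp: Delta_def)
  ultimately have "(P * a (1, 1, 0)) * (b * c) \<le> (b * c) * (b * c)"
    by (simp add: power2_eq_square mult_ac)
  then have "P * a (1, 1, 0) \<le> b * c" using bc by simp
  then show ?thesis by (simp add: P_def b_def c_def)
qed

lemma stable_rhombus:
  assumes st: "half_plane_stable m a" and pos: "\<And>d. d \<in> Delta m \<Longrightarrow> a d > 0"
    and "i + j + k = m" "2 \<le> k"
  shows "ln (a (i, j, k)) + ln (a (i + 1, j + 1, k - 2)) \<le> ln 2 + (ln (a (i + 1, j, k - 1)) + ln (a (i, j + 1, k - 1)))"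
proof -
  obtain k' where k: "k = k' + 2" using assms(4) by (metis add.commute le_Suc_ex)
  have "half_plane_stable 2 (\<lambda>(p, q, r). a (p + i, q + j, r + k'))"
    by (rule half_plane_stable_shift) (use st assms(3) k in \<open>simp add: ac_simps\<close>)
  then have "a (0 + i, 0 + j, 2 + k') * a (1 + i, 1 + j, 0 + k') \<le> 2 * (a (1 + i, 0 + j, 1 + k') * a (0 + i, 1 + j, 1 + k'))"
    by (drule_tac stable_quadratic) (use pos assms(3) k in \<open>auto simp: Delta_def\<close>)
  then have "a (i, j, k) * a (i + 1, j + 1, k - 2) \<le> 2 * (a (i + 1, j, k - 1) * a (i, j + 1, k - 1))"
    by (simp add: k add.commute)
  moreover have p: "a (i, j, k) > 0" "a (i + 1, j + 1, k - 2) > 0" "a (i + 1, j, k - 1) > 0" "a (i, j + 1, k - 1) > 0"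
    using assms(3) k by (auto intro!: pos simp: Delta_def)
  ultimately have "ln (a (i, j, k) * a (i + 1, j + 1, k - 2)) \<le> ln (2 * (a (i + 1, j, k - 1) * a (i, j + 1, k - 1)))"
    by (subst ln_le_cancel_iff) auto
  then show ?thesis using p by (simp add: ln_mult)
qed

section \<open>Positive definite pencils give hives\<close>

definition quad_form :: "nat \<Rightarrow> complex mat \<Rightarrow> complex vec \<Rightarrow> complex" where
  "quad_form n A v = (\<Sum>i<n. \<Sum>j<n. A $$ (i, j) * v $ j * cnj (v $ i))"

lemma scalar_prod_quad_form:
  assumes "A \<in> carrier_mat n n" "v \<in> carrier_vec n"
  shows "(A *\<^sub>v v) \<bullet>c v = quad_form n A v"
  using assms unfolding quad_form_def
  by (auto simp: scalar_prod_def mult_mat_vec_def atLeast0LessThan sum_distrib_right conjugate_complex_def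
      intro!: sum.cong)

lemma pos_def_quad_form:
  assumes "pos_def_hermitian n A" "v \<in> carrier_vec n" "v \<noteq> 0\<^sub>v n"
  shows "\<exists>a>0. quad_form n A v = of_real a"
proof -
  have A: "A \<in> carrier_mat n n" "mat_adjoint A = A" using assms(1) by (auto simp: pos_def_hermitian_def)
  have entry: "cnj (A $$ (i, j)) = A $$ (j, i)" if "i < n" "j < n" for i j
  proof -
    have "mat_adjoint A $$ (j, i) = cnj (A $$ (i, j))"
      using A(1) that unfolding mat_adjoint_def by (simp add: mat_of_rows_def conjugate_complex_def)
    then show ?thesis by (simp add: A(2))
  qed
  have "cnj (quad_form n A v) = (\<Sum>i<n. \<Sum>j<n. A $$ (j, i) * v $ i * cnj (v $ j))"
    unfolding quad_form_def by (auto simp: entry intro!: sum.cong)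
  also have "\<dots> = quad_form n A v"
    unfolding quad_form_def by (rule sum.swap)
  finally have "Im (quad_form n A v) = 0" by (simp add: complex_eq_iff)
  moreover have "0 < Re (quad_form n A v)"
    using assms A(1) by (simp add: pos_def_hermitian_def scalar_prod_quad_form[symmetric])
  ultimately show ?thesis by (intro exI[of _ "Re (quad_form n A v)"]) (simp add: complex_eq_iff)
qed

text \<open>
  For a kernel vector \<open>v\<close>, the values of the three quadratic forms at \<open>v\<close> are positive real numbers
  \<open>a\<close>, \<open>b\<close>, \<open>c\<close> with \<open>a x + b y + c z = 0\<close>. This is impossible in a half-plane.
\<close>

lemma det_pencil_nonzero:
  assumes "pos_def_hermitian n X" "pos_def_hermitian n Y" "pos_def_hermitian n Z"
    and hp: "in_half_plane u x" "in_half_plane u y" "in_half_plane u z" and nz: "\<not> (x = 0 \<and> y = 0 \<and> z = 0)"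
  shows "det (x \<cdot>\<^sub>m X + y \<cdot>\<^sub>m Y + z \<cdot>\<^sub>m Z) \<noteq> 0"
proof
  let ?M = "x \<cdot>\<^sub>m X + y \<cdot>\<^sub>m Y + z \<cdot>\<^sub>m Z"
  have c: "X \<in> carrier_mat n n" "Y \<in> carrier_mat n n" "Z \<in> carrier_mat n n"
    using assms by (auto simp: pos_def_hermitian_def)
  then have M: "?M \<in> carrier_mat n n" by auto
  assume "det ?M = 0"
  then obtain v where v: "v \<in> carrier_vec n" "v \<noteq> 0\<^sub>v n" "?M *\<^sub>v v = 0\<^sub>v n"
    using det_0_iff_vec_prod_zero_field[OF M] by auto
  have "quad_form n ?M v = 0"
    using v scalar_prod_quad_form[OF M v(1)] by simp
  moreover have "quad_form n ?M v = x * quad_form n X v + y * quad_form n Y v + z * quad_form n Z v"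
  proof -
    have entry: "?M $$ (i, j) = x * X $$ (i, j) + y * Y $$ (i, j) + z * Z $$ (i, j)" if "i < n" "j < n" for i j
      using c that by auto
    have "quad_form n ?M v = (\<Sum>i<n. \<Sum>j<n. x * (X $$ (i, j) * v $ j * cnj (v $ i)) +
        y * (Y $$ (i, j) * v $ j * cnj (v $ i)) + z * (Z $$ (i, j) * v $ j * cnj (v $ i)))"
      unfolding quad_form_def by (intro sum.cong refl) (simp only: lessThan_iff entry distrib_right mult.assoc)
    then show ?thesis unfolding quad_form_def by (simp only: sum.distrib sum_distrib_left)
  qed
  moreover obtain a b c where abc: "a > 0" "b > 0" "c > 0"
    "quad_form n X v = of_real a" "quad_form n Y v = of_real b" "quad_form n Z v = of_real c"
    using pos_def_quad_form[OF assms(1) v(1,2)] pos_def_quad_form[OF assms(2) v(1,2)]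
      pos_def_quad_form[OF assms(3) v(1,2)] by blast
  ultimately have "u * (x * of_real a + y * of_real b + z * of_real c) = 0" by simp
  then have "Re (u * (x * of_real a + y * of_real b + z * of_real c)) = 0" by (simp only: zero_complex.sel)
  moreover have "Re (u * (x * of_real a + y * of_real b + z * of_real c)) =
      a * Re (u * x) + b * Re (u * y) + c * Re (u * z)"
    by (simp add: algebra_simps)
  moreover have "0 \<le> Re (u * w) \<and> (w \<noteq> 0 \<longrightarrow> 0 < Re (u * w))" if "in_half_plane u w" for w
    using that by (auto simp: in_half_plane_def)
  ultimately have *: "a * Re (u * x) + b * Re (u * y) + c * Re (u * z) = 0"
    "0 \<le> a * Re (u * x)" "0 \<le> b * Re (u * y)" "0 \<le> c * Re (u * z)"
    "x \<noteq> 0 \<longrightarrow> 0 < a * Re (u * x)" "y \<noteq> 0 \<longrightarrow> 0 < b * Re (u * y)" "z \<noteq> 0 \<longrightarrow> 0 < c * Re (u * z)"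
    using hp abc(1-3) by (auto simp del: times_complex.sel)
  then show False using nz by linarith
qed

lemma pos_def_det_pos:
  assumes "pos_def_hermitian n A"
  shows "\<exists>a>0. det A = of_real a"
proof -
  have A: "A \<in> carrier_mat n n" using assms by (auto simp: pos_def_hermitian_def)
  obtain es where es: "char_poly A = (\<Prod>a\<leftarrow>es. [:- a, 1:])" using char_poly_factorized[OF A] by blast
  define T where "T = schur_upper_triangular A es"
  note T = schur_upper_triangular[OF A es, folded T_def]
  have "det A = prod_list (diag_mat T)"
    using det_similar[OF T(3)] det_upper_triangular[OF T(2,1)] by simp
  moreover have "\<exists>a>0. e = of_real a" if e: "e \<in> set (diag_mat T)" for e
  proof -
    have "char_poly A = (\<Prod>a\<leftarrow>diag_mat T. [:- a, 1:])"
      using char_poly_similar[OF T(3)] char_poly_upper_triangular[OF T(1,2)] by simp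
    then have "poly (char_poly A) e = 0"
      using e by (simp add: poly_prod_list prod_list_zero_iff)
    then obtain v where v: "v \<in> carrier_vec n" "v \<noteq> 0\<^sub>v n" "A *\<^sub>v v = e \<cdot>\<^sub>v v"
      using A by (auto simp: eigenvalue_root_char_poly[OF A, symmetric] eigenvalue_def eigenvector_def)
    obtain a where a: "a > 0" "quad_form n A v = of_real a" using pos_def_quad_form[OF assms v(1,2)] by blast
    have "quad_form n A v = e * (v \<bullet>c v)"
      using scalar_prod_quad_form[OF A v(1)] v by simp
    moreover have "v \<bullet>c v = of_real (\<Sum>i<n. (cmod (v $ i))\<^sup>2)"
    proof -
      have "v \<bullet>c v = (\<Sum>i<n. v $ i * cnj (v $ i))"
        using v(1) by (simp add: scalar_prod_def atLeast0LessThan conjugate_complex_def)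
      then show ?thesis by (simp only: of_real_sum complex_norm_square)
    qed
    moreover define s where "s = (\<Sum>i<n. (cmod (v $ i))\<^sup>2)"
    ultimately have eq: "of_real a = e * of_real s" using a(2) by simp
    moreover have "s \<ge> 0" unfolding s_def by (intro sum_nonneg) auto
    moreover have "s \<noteq> 0" using eq a(1) by auto
    ultimately have "e = of_real (a / s)" "a / s > 0" using a(1) by (auto simp: field_simps)
    then show ?thesis by blast
  qed
  moreover have "(\<And>e. e \<in> set xs \<Longrightarrow> \<exists>a>0. e = complex_of_real a) \<Longrightarrow> \<exists>a>0. prod_list xs = of_real a" for xs
  proof (induction xs)
    case Nil
    then show ?case by (intro exI[of _ 1]) auto
  next
    case (Cons e xs)
    obtain a where "a > 0" "e = of_real a" using Cons.prems[of e] by auto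
    moreover obtain b where "b > 0" "prod_list xs = complex_of_real b" using Cons.IH Cons.prems by force
    ultimately
    show ?case by (intro exI[of _ "a * b"]) auto
  qed
  ultimately show ?thesis by simp
qed

definition normalised :: "real poly3 \<Rightarrow> triple \<Rightarrow> real" where
  "normalised F = (\<lambda>(i, j, k). fact i * fact j * fact k * Poly_Mapping.lookup F (i, j, k))"

lemma detH_normalised:
  assumes "F \<in> detH n"
  shows "half_plane_stable n (normalised F)" "d \<in> Delta n \<Longrightarrow> normalised F d > 0"
proof -
  obtain X Y Z where pd: "pos_def_hermitian n X" "pos_def_hermitian n Y" "pos_def_hermitian n Z"
    and F: "Poly_Mapping.map complex_of_real F = det (pencil X Y Z)"
    using assms by (auto simp: detH_def)
  have c: "X \<in> carrier_mat n n" "Y \<in> carrier_mat n n" "Z \<in> carrier_mat n n"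
    using pd by (auto simp: pos_def_hermitian_def)
  have look: "Poly_Mapping.lookup (det (pencil X Y Z)) d = of_real (Poly_Mapping.lookup F d)" for d
    unfolding F[symmetric] by (simp add: Poly_Mapping.map.rep_eq when_def)
  have ev: "eval3 n (normalised F) x y z = det (x \<cdot>\<^sub>m X + y \<cdot>\<^sub>m Y + z \<cdot>\<^sub>m Z)" for x y z
    unfolding det_pencil_eval[OF c] eval3_def
    by (auto simp: look normalised_def monomial3_def intro!: sum.cong)
  show st: "half_plane_stable n (normalised F)"
    unfolding half_plane_stable_def ev using det_pencil_nonzero[OF pd] by blast
  have corner: "0 < a" if e: "eval3 n (normalised F) x y z = of_real a / fact n"
    and M: "x \<cdot>\<^sub>m X + y \<cdot>\<^sub>m Y + z \<cdot>\<^sub>m Z = M" and pdM: "pos_def_hermitian n M" for x y z a M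
  proof -
    obtain b where "b > 0" "det M = of_real b" using pos_def_det_pos[OF pdM] by blast
    then have "complex_of_real (a / fact n) = of_real b" using e M ev by simp
    then have "a / fact n = b" by (simp only: of_real_eq_iff)
    then show ?thesis using \<open>b > 0\<close> by (metis fact_gt_zero zero_less_divide_iff not_less_iff_gr_or_eq)
  qed
  show "normalised F d > 0" if "d \<in> Delta n"
  proof (rule stable_coeffs_pos[OF st _ _ _ that])
    show "normalised F (n, 0, 0) > 0"
      by (rule corner[of 1 0 0 _ X]) (use c pd in \<open>auto simp: eval3_x intro!: eq_matI\<close>)
    show "normalised F (0, n, 0) > 0"
      by (rule corner[of 0 1 0 _ Y]) (use c pd in \<open>auto simp: eval3_y intro!: eq_matI\<close>)
    show "normalised F (0, 0, n) > 0"
      by (rule corner[of 0 0 1 _ Z]) (use c pd in \<open>auto simp: eval3_z intro!: eq_matI\<close>)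
  qed
qed

definition sq3 :: "triple \<Rightarrow> real" where
  "sq3 = (\<lambda>(i, j, k). (real i)\<^sup>2 + (real j)\<^sup>2 + (real k)\<^sup>2)"

lemma sq3_rhombus:
  assumes "2 \<le> k"
  shows "sq3 (i, j, k) + sq3 (i + 1, j + 1, k - 2) = 2 + (sq3 (i + 1, j, k - 1) + sq3 (i, j + 1, k - 1))"
proof -
  obtain k' where "k = k' + 2" using assms by (metis add.commute le_Suc_ex)
  then show ?thesis by (simp add: sq3_def power2_eq_square algebra_simps)
qed

lemma HIVE_I:
  assumes "h \<in> RDelta n"
    and "\<And>i j k. i + j + k = n \<Longrightarrow> 2 \<le> k \<Longrightarrow>
      h (i, j, k) + h (i + 1, j + 1, k - 2) \<le> h (i + 1, j, k - 1) + h (i, j + 1, k - 1)"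
    and "\<And>i j k. i + j + k = n \<Longrightarrow> 2 \<le> k \<Longrightarrow>
      rot h (i, j, k) + rot h (i + 1, j + 1, k - 2) \<le> rot h (i + 1, j, k - 1) + rot h (i, j + 1, k - 1)"
    and "\<And>i j k. i + j + k = n \<Longrightarrow> 2 \<le> k \<Longrightarrow>
      rot (rot h) (i, j, k) + rot (rot h) (i + 1, j + 1, k - 2) \<le> rot (rot h) (i + 1, j, k - 1) + rot (rot h) (i, j + 1, k - 1)"
  shows "h \<in> HIVE n"
  unfolding HIVE_def
proof (intro CollectI conjI allI impI)
  fix i j k assume d: "(i, j, k) \<in> Delta n"
  show "h (i, j, k) + h (i + 1, j + 1, k - 2) \<le> h (i + 1, j, k - 1) + h (i, j + 1, k - 1)" if "2 \<le> k"
    using assms(2)[of i j k] d that by (simp add: Delta_def)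
  show "h (i, j, k) + h (i - 2, j + 1, k + 1) \<le> h (i - 1, j + 1, k) + h (i - 1, j, k + 1)" if "2 \<le> i"
    using assms(3)[of j k i] d that by (simp add: Delta_def)
  show "h (i, j, k) + h (i + 1, j - 2, k + 1) \<le> h (i + 1, j - 1, k) + h (i, j - 1, k + 1)" if "2 \<le> j"
    using assms(4)[of k i j] d that by (simp add: Delta_def add.commute)
qed (rule assms(1))

text \<open>
  The logarithms of factorials undo the normalisation of the coefficients, and the squares
  compensate the factor \<open>2\<close> in the rhombus inequality for stable polynomials.
\<close>

definition outer_apex :: "nat \<Rightarrow> triple \<Rightarrow> real" where
  "outer_apex n = (\<lambda>d. if d \<in> Delta n then sq3 d - (case d of (i, j, k) \<Rightarrow> ln (fact i * fact j * fact k)) else 0)"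

lemma log_coeffs_in_hives:
  assumes F: "F \<in> detH n"
  shows "log_coeffs n F \<in> translate (outer_apex n) (HIVE n)"
proof -
  define a where "a = normalised F"
  define h where "h d = log_coeffs n F d - outer_apex n d" for d
  note st = detH_normalised(1)[OF F, folded a_def] and pos = detH_normalised(2)[OF F, folded a_def]
  have h: "h d = ln (a d) - sq3 d" if "d \<in> Delta n" for d
  proof -
    obtain i j k where d: "d = (i, j, k)" by (cases d) auto
    have "fact i * fact j * fact k * Poly_Mapping.lookup F d > 0"
      using pos[OF that] by (simp add: a_def normalised_def d)
    then have "Poly_Mapping.lookup F d > 0" by (rule zero_less_mult_pos) simp
    then show ?thesis using that
      by (simp add: h_def log_coeffs_def outer_apex_def a_def normalised_def d ln_mult)
  qed
  have rhombus: "g (i, j, k) + g (i + 1, j + 1, k - 2) \<le> g (i + 1, j, k - 1) + g (i, j + 1, k - 1)"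
    if g: "\<And>d. d \<in> Delta n \<Longrightarrow> g d = ln (b d) - sq3 d"
      and b: "half_plane_stable n b" "\<And>d. d \<in> Delta n \<Longrightarrow> b d > 0" and ijk: "i + j + k = n" "2 \<le> k"
    for g b i j k
  proof -
    have "ln 2 \<le> (2 :: real)" using ln_le_minus_one[of 2] by simp
    then show ?thesis
      using stable_rhombus[OF b ijk] sq3_rhombus[OF ijk(2), of i j] ijk
      by (simp add: g Delta_def)
  qed
  have "h \<in> HIVE n"
  proof (rule HIVE_I)
    show "h \<in> RDelta n" by (simp add: RDelta_def h_def log_coeffs_def outer_apex_def)
  next
    fix i j k :: nat assume ijk: "i + j + k = n" "2 \<le> k"
    show "h (i, j, k) + h (i + 1, j + 1, k - 2) \<le> h (i + 1, j, k - 1) + h (i, j + 1, k - 1)"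
      by (rule rhombus[OF h st pos ijk])
    show "rot h (i, j, k) + rot h (i + 1, j + 1, k - 2) \<le> rot h (i + 1, j, k - 1) + rot h (i, j + 1, k - 1)"
      by (rule rhombus[of "rot h" "rot a", OF _ _ _ ijk])
         (use st in \<open>auto simp: Delta_def h sq3_def intro!: pos\<close>)
    show "rot (rot h) (i, j, k) + rot (rot h) (i + 1, j + 1, k - 2) \<le> rot (rot h) (i + 1, j, k - 1) + rot (rot h) (i, j + 1, k - 1)"
      by (rule rhombus[of "rot (rot h)" "rot (rot a)", OF _ _ _ ijk])
         (use st in \<open>auto simp: Delta_def h sq3_def intro!: pos\<close>)
  qed
  moreover have "log_coeffs n F = (\<lambda>d. outer_apex n d + h d)" by (simp add: h_def)
  ultimately show ?thesis unfolding translate_def by blast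
qed

section \<open>A fixed point theorem for cubes\<close>

lemma tendsto_funI:
  fixes X :: "'b \<Rightarrow> 'a \<Rightarrow> real"
  assumes "\<And>i. ((\<lambda>p. X p i) \<longlongrightarrow> x i) F"
  shows "(X \<longlongrightarrow> x) F"
  unfolding limitin_canonical_iff[symmetric] euclidean_product_topology[symmetric]
  using assms by (simp add: limitin_componentwise)

lemma compact_cube: "compact {x :: nat \<Rightarrow> real. \<forall>i. x i \<in> {0..1}}"
proof -
  have "{x :: nat \<Rightarrow> real. \<forall>i. x i \<in> {0..1}} = PiE UNIV (\<lambda>_. {0..1})" by (auto simp: PiE_def Pi_def)
  moreover have "compactin (product_topology (\<lambda>i. euclidean) UNIV) (PiE UNIV (\<lambda>_ :: nat. {0..1 :: real}))"
    by (subst compactin_PiE) simp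
  ultimately show ?thesis by (simp only: euclidean_product_topology compactin_euclidean_iff)
qed

text \<open>
  Brouwer's theorem in a dimension that is a number and not a type. Kuhn's lemma is applied on
  grids of mesh \<open>1 / (p + 1)\<close> to the labelling that records whether a coordinate increases under
  \<open>f\<close>; an accumulation point of the resulting small cubes is a fixed point.
\<close>

lemma brouwer_cube:
  fixes f :: "(nat \<Rightarrow> real) \<Rightarrow> nat \<Rightarrow> real"
  assumes cont: "\<And>i. i < N \<Longrightarrow> continuous_on UNIV (\<lambda>x. f x i)"
    and range: "\<And>x i. (\<And>j. 0 \<le> x j \<and> x j \<le> 1) \<Longrightarrow> i < N \<Longrightarrow> 0 \<le> f x i \<and> f x i \<le> 1"
  shows "\<exists>x. (\<forall>i. 0 \<le> x i \<and> x i \<le> 1) \<and> (\<forall>i<N. f x i = x i)"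
proof -
  define pt where "pt p q i = (if i < N then real (q i) / real p else 0)" for p :: nat and q :: "nat \<Rightarrow> nat" and i
  have step: "\<exists>q. (\<forall>i<N. q i < Suc p) \<and> (\<forall>i<N. \<exists>r s.
      (\<forall>j<N. q j \<le> r j \<and> r j \<le> q j + 1) \<and> (\<forall>j<N. q j \<le> s j \<and> s j \<le> q j + 1) \<and>
      pt (Suc p) r i \<le> f (pt (Suc p) r) i \<and> f (pt (Suc p) s) i \<le> pt (Suc p) s i)" for p
  proof -
    let ?p = "Suc p"
    (* The first condition forces the label 1 on the upper faces even where f fixes the coordinate. *)
    define label where "label x i = (if x i < ?p \<and> pt ?p x i \<le> f (pt ?p x) i then 0 else 1 :: nat)" for x i
    have cube: "0 \<le> pt ?p x j \<and> pt ?p x j \<le> 1" if "\<forall>i<N. x i \<le> ?p" for x j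
      using that by (auto simp: pt_def simp del: of_nat_Suc)
    have l0: "pt ?p x i \<le> f (pt ?p x) i" if "label x i = 0" for x i
      using that by (auto simp: label_def split: if_splits)
    have l1: "f (pt ?p x) i \<le> pt ?p x i" if "label x i = 1" "\<forall>i<N. x i \<le> ?p" "i < N" for x i
    proof (cases "x i < ?p")
      case True
      then show ?thesis using that(1) by (auto simp: label_def split: if_splits)
    next
      case False
      moreover have "x i \<le> ?p" using that(2,3) by blast
      ultimately have "x i = ?p" by simp
      then have "pt ?p x i = 1" using that(3) by (simp add: pt_def del: of_nat_Suc)
      moreover have "f (pt ?p x) i \<le> 1" by (rule conjunct2[OF range[OF cube[OF that(2)] that(3)]])
      ultimately show ?thesis by simp
    qed
    obtain q where q: "\<forall>i<N. q i < ?p"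
      "\<forall>i<N. \<exists>r s. (\<forall>j<N. q j \<le> r j \<and> r j \<le> q j + 1) \<and> (\<forall>j<N. q j \<le> s j \<and> s j \<le> q j + 1) \<and> label r i \<noteq> label s i"
    proof (rule kuhn_lemma[of ?p N label])
      show "\<forall>x. (\<forall>i<N. x i \<le> ?p) \<longrightarrow> (\<forall>i<N. x i = 0 \<longrightarrow> label x i = 0)"
      proof (intro allI impI)
        fix x i assume x: "\<forall>i<N. x i \<le> ?p" "i < N" "x i = 0"
        have "0 \<le> f (pt ?p x) i" by (rule conjunct1[OF range[OF cube[OF x(1)] x(2)]])
        then show "label x i = 0" using x by (simp add: label_def pt_def)
      qed
    qed (auto simp: label_def)
    have "\<exists>r s. (\<forall>j<N. q j \<le> r j \<and> r j \<le> q j + 1) \<and> (\<forall>j<N. q j \<le> s j \<and> s j \<le> q j + 1) \<and>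
      pt ?p r i \<le> f (pt ?p r) i \<and> f (pt ?p s) i \<le> pt ?p s i" if i: "i < N" for i
    proof -
      obtain r s where rs: "\<forall>j<N. q j \<le> r j \<and> r j \<le> q j + 1" "\<forall>j<N. q j \<le> s j \<and> s j \<le> q j + 1"
        "label r i \<noteq> label s i" using q(2) i by blast
      have bd: "\<forall>i<N. r i \<le> ?p" "\<forall>i<N. s i \<le> ?p" using rs(1,2) q(1) by fastforce+
      have lab: "label x i = 0 \<or> label x i = 1" for x by (simp add: label_def)
      show ?thesis
      proof (cases "label r i = 0")
        case True
        then have "label s i = 1" using rs(3) lab[of s] by auto
        then show ?thesis
          using rs(1,2) l0[OF True] l1[of s, OF _ bd(2) i] by (intro exI[of _ r] exI[of _ s] conjI) simp_all
      next
        case False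
        then have "label r i = 1" "label s i = 0" using rs(3) lab[of s] lab[of r] by auto
        then show ?thesis
          using rs(1,2) l0[of s] l1[of r, OF _ bd(1) i] by (intro exI[of _ s] exI[of _ r] conjI) simp_all
      qed
    qed
    then show ?thesis using q(1) by blast
  qed
  then obtain Q where Q: "\<And>p i. i < N \<Longrightarrow> Q p i < Suc p"
    "\<And>p i. i < N \<Longrightarrow> \<exists>r s. (\<forall>j<N. Q p j \<le> r j \<and> r j \<le> Q p j + 1) \<and> (\<forall>j<N. Q p j \<le> s j \<and> s j \<le> Q p j + 1) \<and>
      pt (Suc p) r i \<le> f (pt (Suc p) r) i \<and> f (pt (Suc p) s) i \<le> pt (Suc p) s i"
    by metis
  define y where "y p = pt (Suc p) (Q p)" for p
  have "y p \<in> {x. \<forall>i. x i \<in> {0..1}}" for p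
    using Q(1)[of _ p] by (auto simp: y_def pt_def less_imp_le simp del: of_nat_Suc)
  moreover have "seq_compact {x :: nat \<Rightarrow> real. \<forall>i. x i \<in> {0..1}}"
    using compact_cube compact_imp_seq_compact by blast
  ultimately obtain x \<sigma> where x: "x \<in> {x. \<forall>i. x i \<in> {0..1}}" and \<sigma>: "strict_mono \<sigma>" and lim: "(y \<circ> \<sigma>) \<longlonglongrightarrow> x"
    unfolding seq_compact_def by (metis (no_types, lifting))
  have limi: "(\<lambda>p. y (\<sigma> p) i) \<longlonglongrightarrow> x i" for i
    using continuous_on_tendsto_compose[OF continuous_on_product_coordinates[of i] lim] by (simp add: o_def)
  have near: "(\<lambda>p. pt (Suc (\<sigma> p)) (r p)) \<longlonglongrightarrow> x"
    if r: "\<And>p j. j < N \<Longrightarrow> Q (\<sigma> p) j \<le> r p j \<and> r p j \<le> Q (\<sigma> p) j + 1" for r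
  proof -
    have "(\<lambda>p. pt (Suc (\<sigma> p)) (r p) i) \<longlonglongrightarrow> x i" for i
    proof -
      have "(\<lambda>p. inverse (real (Suc p))) \<longlonglongrightarrow> 0" by (rule LIMSEQ_inverse_real_of_nat)
      then have L: "(\<lambda>p. inverse (real (Suc (\<sigma> p)))) \<longlonglongrightarrow> 0"
        using LIMSEQ_subseq_LIMSEQ[OF _ \<sigma>, of "\<lambda>p. inverse (real (Suc p))"] by (simp only: o_def)
      have B: "norm (pt (Suc (\<sigma> p)) (r p) i - y (\<sigma> p) i) \<le> inverse (real (Suc (\<sigma> p)))" for p
      proof (cases "i < N")
        case True
        then have "\<bar>real (r p i) - real (Q (\<sigma> p) i)\<bar> \<le> 1" using r[of i p] by linarith
        then have "\<bar>real (r p i) - real (Q (\<sigma> p) i)\<bar> / real (Suc (\<sigma> p)) \<le> 1 / real (Suc (\<sigma> p))"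
          by (intro divide_right_mono) auto
        then show ?thesis using True
          by (simp add: y_def pt_def inverse_eq_divide diff_divide_distrib[symmetric] abs_divide del: of_nat_Suc)
      qed (simp add: y_def pt_def)
      have "(\<lambda>p. pt (Suc (\<sigma> p)) (r p) i - y (\<sigma> p) i) \<longlonglongrightarrow> 0"
        by (rule Lim_null_comparison[OF eventuallyI[OF B] L])
      from tendsto_add[OF this limi[of i]] show ?thesis by simp
    qed
    then show ?thesis by (rule tendsto_funI)
  qed
  have "f x i = x i" if i: "i < N" for i
  proof -
    have "\<forall>p. \<exists>r s. (\<forall>j<N. Q (\<sigma> p) j \<le> r j \<and> r j \<le> Q (\<sigma> p) j + 1) \<and>
      (\<forall>j<N. Q (\<sigma> p) j \<le> s j \<and> s j \<le> Q (\<sigma> p) j + 1) \<and>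
      pt (Suc (\<sigma> p)) r i \<le> f (pt (Suc (\<sigma> p)) r) i \<and> f (pt (Suc (\<sigma> p)) s) i \<le> pt (Suc (\<sigma> p)) s i"
      using Q(2)[OF i] by (intro allI)
    from choice[OF this] obtain r where "\<forall>p. \<exists>s. (\<forall>j<N. Q (\<sigma> p) j \<le> r p j \<and> r p j \<le> Q (\<sigma> p) j + 1) \<and>
      (\<forall>j<N. Q (\<sigma> p) j \<le> s j \<and> s j \<le> Q (\<sigma> p) j + 1) \<and>
      pt (Suc (\<sigma> p)) (r p) i \<le> f (pt (Suc (\<sigma> p)) (r p)) i \<and> f (pt (Suc (\<sigma> p)) s) i \<le> pt (Suc (\<sigma> p)) s i" ..
    from choice[OF this] obtain s where rs: "\<forall>p. (\<forall>j<N. Q (\<sigma> p) j \<le> r p j \<and> r p j \<le> Q (\<sigma> p) j + 1) \<and>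
      (\<forall>j<N. Q (\<sigma> p) j \<le> s p j \<and> s p j \<le> Q (\<sigma> p) j + 1) \<and>
      pt (Suc (\<sigma> p)) (r p) i \<le> f (pt (Suc (\<sigma> p)) (r p)) i \<and> f (pt (Suc (\<sigma> p)) (s p)) i \<le> pt (Suc (\<sigma> p)) (s p) i" ..
    have coord: "(\<lambda>p. pt (Suc (\<sigma> p)) (r p) i) \<longlonglongrightarrow> x i"
      if "(\<lambda>p. pt (Suc (\<sigma> p)) (r p)) \<longlonglongrightarrow> x" for r
      using continuous_on_tendsto_compose[OF continuous_on_product_coordinates[of i] that] by simp
    have val: "(\<lambda>p. f (pt (Suc (\<sigma> p)) (r p)) i) \<longlonglongrightarrow> f x i"
      if "(\<lambda>p. pt (Suc (\<sigma> p)) (r p)) \<longlonglongrightarrow> x" for r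
      using continuous_on_tendsto_compose[OF cont[OF i] that] by simp
    have nr: "(\<lambda>p. pt (Suc (\<sigma> p)) (r p)) \<longlonglongrightarrow> x" and ns: "(\<lambda>p. pt (Suc (\<sigma> p)) (s p)) \<longlonglongrightarrow> x"
      using rs by (intro near; blast)+
    have "x i \<le> f x i"
      by (rule LIMSEQ_le[OF coord[OF nr] val[OF nr]]) (use rs in blast)
    moreover have "f x i \<le> x i"
      by (rule LIMSEQ_le[OF val[OF ns] coord[OF ns]]) (use rs in blast)
    ultimately show ?thesis by simp
  qed
  then show ?thesis using x by auto
qed

section \<open>Gram determinants and principal minors\<close>

lemma det_mat_transpose:
  fixes f :: "nat \<Rightarrow> nat \<Rightarrow> 'a::comm_ring_1"
  shows "det (mat m m (\<lambda>(i, j). f j i)) = det (mat m m (\<lambda>(i, j). f i j))"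
proof -
  have "mat m m (\<lambda>(i, j). f j i) = transpose_mat (mat m m (\<lambda>(i, j). f i j))"
    by (intro eq_matI) auto
  then show ?thesis by (simp add: det_transpose[of _ m])
qed

text \<open>
  The Cauchy-Binet formula for \<open>A A\<^sup>T\<close>, summed over all maps of indices instead of increasing ones.
  Each set of columns then occurs once for each of its orderings, and sets with repetitions
  contribute \<open>0\<close>.
\<close>

lemma det_gram:
  fixes A :: "nat \<Rightarrow> nat \<Rightarrow> real"
  shows "fact m * det (mat m m (\<lambda>(i, j). \<Sum>u<n. A i u * A j u)) =
    (\<Sum>f\<in>(\<Pi>\<^sub>E i\<in>{..<m}. {..<n}). (det (mat m m (\<lambda>(i, j). A i (f j))))\<^sup>2)"
proof -
  define d where "d f = det (mat m m (\<lambda>(i, j). A j (f i)))" for f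
  let ?F = "\<Pi>\<^sub>E i\<in>{..<m}. {..<n}"
  let ?G = "det (mat m m (\<lambda>(i, j). \<Sum>u<n. A i u * A j u))"
  have G: "?G = (\<Sum>f\<in>?F. (\<Prod>i<m. A i (f i)) * d f)"
    unfolding d_def by (subst det_mat_sum) (simp_all add: det_mat_scale_rows)
  (* Composing the summation index with p permutes the rows of the second factor; averaging over
     p produces the determinant from the first factor. *)
  have perm: "?G = (\<Sum>f\<in>?F. of_int (sign p) * (\<Prod>i<m. A i (f (p i))) * d f)" if p: "p permutes {..<m}" for p
  proof -
    have pm: "p i < m \<longleftrightarrow> i < m" for i using permutes_in_image[OF p, of i] by simp
    obtain p' where p': "p' permutes {..<m}" "\<And>i. p (p' i) = i" "\<And>i. p' (p i) = i"
      using permutes_inv[OF p] permutes_inverses[OF p] by blast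
    have pm': "p' i < m \<longleftrightarrow> i < m" for i using permutes_in_image[OF p'(1), of i] by simp
    have dp: "d (\<lambda>i\<in>{..<m}. f (p i)) = of_int (sign p) * d f" for f
    proof -
      have "mat m m (\<lambda>(i, j). A j ((\<lambda>i\<in>{..<m}. f (p i)) i)) =
          mat m m (\<lambda>(i, j). mat m m (\<lambda>(i, j). A j (f i)) $$ (p i, j))"
        by (intro eq_matI) (auto simp: pm)
      then show ?thesis unfolding d_def
        using det_permute_rows[of "mat m m (\<lambda>(i, j). A j (f i))" m p] p by (simp add: atLeast0LessThan)
    qed
    have "?G = (\<Sum>f\<in>?F. (\<Prod>i<m. A i ((\<lambda>i\<in>{..<m}. f (p i)) i)) * d (\<lambda>i\<in>{..<m}. f (p i)))"
      unfolding G
      by (rule sum.reindex_bij_witness[of _ "\<lambda>f. \<lambda>i\<in>{..<m}. f (p i)" "\<lambda>f. \<lambda>i\<in>{..<m}. f (p' i)"])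
         (auto simp: fun_eq_iff PiE_iff extensional_def p' pm pm' intro!: prod.cong arg_cong2[where f = "(*)"] arg_cong[where f = d])
    then show ?thesis by (simp add: dp mult_ac)
  qed
  have "fact m * ?G = (\<Sum>p | p permutes {..<m}. ?G)"
    by (simp add: card_permutations[of "{..<m}" m])
  also have "\<dots> = (\<Sum>p | p permutes {..<m}. \<Sum>f\<in>?F. of_int (sign p) * (\<Prod>i<m. A i (f (p i))) * d f)"
    by (intro sum.cong refl perm) simp
  also have "\<dots> = (\<Sum>f\<in>?F. (\<Sum>p | p permutes {..<m}. of_int (sign p) * (\<Prod>i<m. A i (f (p i)))) * d f)"
    by (subst sum.swap) (simp add: sum_distrib_right)
  also have "\<dots> = (\<Sum>f\<in>?F. (det (mat m m (\<lambda>(i, j). A i (f j))))\<^sup>2)"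
  proof (intro sum.cong refl)
    fix f
    show "(\<Sum>p | p permutes {..<m}. of_int (sign p) * (\<Prod>i<m. A i (f (p i)))) * d f = (det (mat m m (\<lambda>(i, j). A i (f j))))\<^sup>2"
      unfolding d_def det_mat_transpose[of m "\<lambda>i j. A i (f j)"]
      by (subst det_mat_permutations[symmetric]) (simp add: power2_eq_square)
  qed
  finally show ?thesis .
qed

lemma det_principal_minor:
  fixes X :: "nat \<Rightarrow> nat \<Rightarrow> 'a::comm_ring_1"
  assumes S: "S \<subseteq> {..<n}" and e: "bij_betw e {..<m} S"
  shows "det (mat n n (\<lambda>(i, j). if i \<in> S then X i j else if i = j then 1 else 0)) =
    det (mat m m (\<lambda>(i, j). X (e i) (e j)))"
proof -
  let ?g = "\<lambda>i j. if i \<in> S then X i j else if i = j then 1 else 0 :: 'a"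
  obtain e' where e': "bij_betw e' S {..<m}" "\<And>x. x \<in> {..<m} \<Longrightarrow> e' (e x) = x" "\<And>x. x \<in> S \<Longrightarrow> e (e' x) = x"
    using bij_betw_inv_into[OF e] bij_betw_inv_into_left[OF e] bij_betw_inv_into_right[OF e] by blast
  have inj: "inj_on e {..<m}" and img: "e ` {..<m} = S" using e by (auto simp: bij_betw_def)
  have sub: "{p. p permutes S} \<subseteq> {p. p permutes {..<n}}" using permutes_subset[OF _ S] by blast
  have "det (mat n n (\<lambda>(i, j). ?g i j)) = (\<Sum>p | p permutes {..<n}. of_int (sign p) * (\<Prod>i<n. ?g i (p i)))"
    by (rule det_mat_permutations)
  also have "\<dots> = (\<Sum>p | p permutes S. of_int (sign p) * (\<Prod>i\<in>S. X i (p i)))"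
  proof (rule sum.mono_neutral_cong_right[OF _ sub])
    show "finite {p. p permutes {..<n}}" by (simp add: finite_permutations)
    show "\<forall>p\<in>{p. p permutes {..<n}} - {p. p permutes S}. of_int (sign p) * (\<Prod>i<n. ?g i (p i)) = 0"
    proof
      fix p assume p: "p \<in> {p. p permutes {..<n}} - {p. p permutes S}"
      have "\<exists>i. i \<notin> S \<and> p i \<noteq> i"
      proof (rule ccontr)
        assume "\<nexists>i. i \<notin> S \<and> p i \<noteq> i"
        moreover have "bij p" using p permutes_bij by blast
        ultimately have "p permutes S" using p by (auto simp: permutes_def)
        then show False using p by simp
      qed
      then obtain i where i: "i \<notin> S" "p i \<noteq> i" by blast
      then have "i < n" using p by (auto simp: permutes_def)
      then have "(\<Prod>i<n. ?g i (p i)) = 0" using i by (intro prod_zero) auto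
      then show "of_int (sign p) * (\<Prod>i<n. ?g i (p i)) = 0" by simp
    qed
    fix p assume "p \<in> {p. p permutes S}"
    then have p: "p i = i" if "i \<notin> S" for i using that by (auto simp: permutes_def)
    have "(\<Prod>i<n. ?g i (p i)) = (\<Prod>i\<in>S. X i (p i))"
      by (rule prod.mono_neutral_cong_right) (use S p in auto)
    then show "of_int (sign p) * (\<Prod>i<n. ?g i (p i)) = of_int (sign p) * (\<Prod>i\<in>S. X i (p i))" by simp
  qed
  also have "\<dots> = (\<Sum>q | q permutes {..<m}. of_int (sign q) * (\<Prod>r<m. X (e r) (e (q r))))"
  proof (rule sum.reindex_bij_witness[symmetric, of _ "map_permutation S e'" "map_permutation {..<m} e"])
    fix q assume "q \<in> {q. q permutes {..<m}}"
    then have q: "q permutes {..<m}" by simp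
    show "map_permutation S e' (map_permutation {..<m} e q) = q"
      by (rule map_permutation_compose_inv[OF e q e'(2)])
    show "map_permutation {..<m} e q \<in> {p. p permutes S}"
      using map_permutation_permutes[OF e q] by simp
    have "(\<Prod>i\<in>S. X i (map_permutation {..<m} e q i)) = (\<Prod>r<m. X (e r) (map_permutation {..<m} e q (e r)))"
      unfolding img[symmetric] by (simp add: prod.reindex[OF inj])
    also have "\<dots> = (\<Prod>r<m. X (e r) (e (q r)))"
      by (intro prod.cong refl) (simp add: map_permutation_apply[OF inj])
    finally show "of_int (sign (map_permutation {..<m} e q)) * (\<Prod>i\<in>S. X i (map_permutation {..<m} e q i)) =
      of_int (sign q) * (\<Prod>r<m. X (e r) (e (q r)))"
      by (simp add: sign_map_permutation[OF inj q])
  next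
    fix p assume "p \<in> {p. p permutes S}"
    then have p: "p permutes S" by simp
    show "map_permutation {..<m} e (map_permutation S e' p) = p"
      by (rule map_permutation_compose_inv[OF e'(1) p e'(3)])
    show "map_permutation S e' p \<in> {q. q permutes {..<m}}"
      using map_permutation_permutes[OF e'(1) p] by simp
  qed
  also have "\<dots> = det (mat m m (\<lambda>(i, j). X (e i) (e j)))"
    by (rule det_mat_permutations[symmetric])
  finally show ?thesis .
qed

lemma det_mat_of_real:
  "det (mat m m (\<lambda>(i, j). complex_of_real (f i j))) = of_real (det (mat m m (\<lambda>(i, j). f i j)))"
  unfolding det_mat_permutations by simp

section \<open>The pencil of a hive\<close>

definition letter :: "nat \<Rightarrow> (nat \<Rightarrow> nat) \<Rightarrow> nat \<Rightarrow> nat set" where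
  "letter n \<phi> l = {r. r < n \<and> \<phi> r = l}"

text \<open>
  The increasing enumeration of the rows in which the letter \<open>x\<close> is chosen.
\<close>

definition place :: "nat \<Rightarrow> (nat \<Rightarrow> nat) \<Rightarrow> nat \<Rightarrow> nat" where
  "place n \<phi> r = sorted_list_of_set (letter n \<phi> 0) ! r"

lemma finite_letter [simp]: "finite (letter n \<phi> l)" by (simp add: letter_def)

lemma place_less:
  assumes "r < r'" "r' < card (letter n \<phi> 0)"
  shows "place n \<phi> r < place n \<phi> r'"
  unfolding place_def
  by (rule sorted_wrt_nth_less[OF strict_sorted_list_of_set]) (use assms in auto)

lemma bij_betw_place: "bij_betw (place n \<phi>) {..<card (letter n \<phi> 0)} (letter n \<phi> 0)"
  unfolding place_def by (rule bij_betw_nth) auto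

text \<open>
  The contribution of a word to the determinant of the pencil that is defined next: the rows with
  letter \<open>x\<close> give a principal minor of \<open>A A\<^sup>T\<close>, expanded by the Cauchy-Binet formula, and those with
  letter \<open>z\<close> give the factors \<open>exp (- slope H 0 r)\<close>. These are combined with the overall scalar
  \<open>exp (H 0 n)\<close> into the slopes at the remaining rows.
\<close>

definition word_term :: "nat \<Rightarrow> (nat \<Rightarrow> nat \<Rightarrow> real) \<Rightarrow> (nat \<Rightarrow> nat) \<Rightarrow> real" where
  "word_term n H \<phi> = (let m = card (letter n \<phi> 0) in
     exp (H 0 0 + (\<Sum>r\<in>{..<n} - letter n \<phi> 2. slope H 0 r)) / fact m *
     (\<Sum>f\<in>(\<Pi>\<^sub>E i\<in>{..<m}. {..<n}). (net_minor n (weight H) 0 m (place n \<phi>) f)\<^sup>2))"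

definition net_coeff :: "nat \<Rightarrow> (nat \<Rightarrow> nat \<Rightarrow> real) \<Rightarrow> triple \<Rightarrow> real" where
  "net_coeff n H d = (\<Sum>\<phi> | \<phi> \<in> words n \<and> word_content n \<phi> = d. word_term n H \<phi>)"

text \<open>
  The factor \<open>exp (H 0 n / n)\<close> is common to the three matrices and multiplies the determinant by
  \<open>exp (H 0 n)\<close>, which is the coefficient of \<open>y\<^sup>n\<close>.
\<close>

definition gram_mat :: "nat \<Rightarrow> (nat \<Rightarrow> nat \<Rightarrow> real) \<Rightarrow> complex mat" where
  "gram_mat n H = mat n n (\<lambda>(i, j). of_real (exp (H 0 n / n) *
     (\<Sum>u<n. net n (weight H) 0 i u * net n (weight H) 0 j u)))"

definition diagonal_mat_of :: "nat \<Rightarrow> (nat \<Rightarrow> real) \<Rightarrow> complex mat" where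
  "diagonal_mat_of n c = mat n n (\<lambda>(i, j). of_real (if i = j then c i else 0))"

lemma word_content_letter:
  assumes "\<phi> \<in> words n" "word_content n \<phi> = (i, j, k)"
  shows "card (letter n \<phi> 0) = i" "card (letter n \<phi> 2) = k" "card ({..<n} - letter n \<phi> 2) = i + j"
proof -
  show "card (letter n \<phi> 0) = i" and k: "card (letter n \<phi> 2) = k"
    using word_content_eq[OF assms(1)] assms(2) by (simp_all add: letter_def)
  have "i + j + k = n" using word_content_in_Delta[OF assms(1)] assms(2) by (simp add: Delta_def)
  moreover have "letter n \<phi> 2 \<subseteq> {..<n}" by (auto simp: letter_def)
  ultimately show "card ({..<n} - letter n \<phi> 2) = i + j"
    using k by (simp add: card_Diff_subset)
qed

lemma mixed_det_net:
  assumes n: "n \<ge> 1" and \<phi>: "\<phi> \<in> words n"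
  shows "mixed_det n (gram_mat n H) (diagonal_mat_of n (\<lambda>_. exp (H 0 n / n)))
    (diagonal_mat_of n (\<lambda>r. exp (H 0 n / n - slope H 0 r))) \<phi> = of_real (word_term n H \<phi>)"
proof -
  let ?X = "\<lambda>i j. \<Sum>u<n. net n (weight H) 0 i u * net n (weight H) 0 j u"
  let ?S = "letter n \<phi> 0" and ?Z = "letter n \<phi> 2"
  let ?m = "card ?S"
  define \<kappa> where "\<kappa> r = exp (H 0 n / n - (if r \<in> ?Z then slope H 0 r else 0))" for r
  define G where "G r c = (if r \<in> ?S then ?X r c else if r = c then 1 else 0)" for r c
  have "select3 (gram_mat n H) (diagonal_mat_of n (\<lambda>_. exp (H 0 n / n)))
      (diagonal_mat_of n (\<lambda>r. exp (H 0 n / n - slope H 0 r))) (\<phi> r) $$ (r, c) = of_real (\<kappa> r * G r c)"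
    if rc: "r < n" "c < n" for r c
  proof -
    have "\<phi> r < 3" using \<phi> rc(1) by (auto simp: words_def)
    then consider "\<phi> r = 0" | "\<phi> r = 1" | "\<phi> r = 2" by linarith
    then show ?thesis
      by cases (use rc in \<open>simp_all add: select3_def gram_mat_def diagonal_mat_of_def \<kappa>_def G_def letter_def\<close>)
  qed
  then have "mixed_det n (gram_mat n H) (diagonal_mat_of n (\<lambda>_. exp (H 0 n / n)))
      (diagonal_mat_of n (\<lambda>r. exp (H 0 n / n - slope H 0 r))) \<phi> =
      det (mat n n (\<lambda>(r, c). complex_of_real (\<kappa> r * G r c)))"
    unfolding mixed_det_def by (intro arg_cong[where f = det] cong_mat) (simp_all only: prod.case)
  also have "\<dots> = of_real ((\<Prod>r<n. \<kappa> r) * det (mat n n (\<lambda>(r, c). G r c)))"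
    unfolding det_mat_of_real det_mat_scale_rows ..
  also have "det (mat n n (\<lambda>(r, c). G r c)) = det (mat ?m ?m (\<lambda>(i, j). ?X (place n \<phi> i) (place n \<phi> j)))"
    unfolding G_def by (rule det_principal_minor[OF _ bij_betw_place]) (auto simp: letter_def)
  also have "\<dots> = (\<Sum>f\<in>(\<Pi>\<^sub>E i\<in>{..<?m}. {..<n}). (net_minor n (weight H) 0 ?m (place n \<phi>) f)\<^sup>2) / fact ?m"
    unfolding net_minor_def
    using det_gram[where m = ?m and n = n and A = "\<lambda>i u. net n (weight H) 0 (place n \<phi> i) u"] by (simp add: field_simps)
  also have "(\<Prod>r<n. \<kappa> r) = exp (H 0 0 + (\<Sum>r\<in>{..<n} - ?Z. slope H 0 r))"
  proof -
    have Z: "?Z \<subseteq> {..<n}" by (auto simp: letter_def)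
    have "(\<Prod>r<n. \<kappa> r) = exp (\<Sum>r<n. H 0 n / n - (if r \<in> ?Z then slope H 0 r else 0))"
      unfolding \<kappa>_def by (rule exp_sum[symmetric]) simp
    also have "(\<Sum>r<n. H 0 n / n - (if r \<in> ?Z then slope H 0 r else 0)) = H 0 n - (\<Sum>r\<in>?Z. slope H 0 r)"
      using n Z by (simp add: sum_subtractf sum.If_cases Int_absorb1 Int_absorb2)
    also have "\<dots> = H 0 0 + (\<Sum>r\<in>{..<n} - ?Z. slope H 0 r)"
      using sum.subset_diff[OF Z finite_lessThan, where g = "slope H 0"] sum_slope[where H = H and t = 0 and j = n] by simp
    finally show ?thesis .
  qed
  finally show ?thesis by (simp add: word_term_def Let_def)
qed

lemma real_pos_def_hermitian:
  fixes f :: "nat \<Rightarrow> nat \<Rightarrow> real"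
  assumes "\<And>i j. f i j = f j i"
    and "\<And>v :: complex vec. v \<in> carrier_vec n \<Longrightarrow> v \<noteq> 0\<^sub>v n \<Longrightarrow>
      0 < Re (\<Sum>i<n. \<Sum>j<n. of_real (f i j) * v $ j * cnj (v $ i))"
  shows "pos_def_hermitian n (mat n n (\<lambda>(i, j). of_real (f i j)))"
proof -
  let ?A = "mat n n (\<lambda>(i, j). complex_of_real (f i j))"
  have "mat_adjoint ?A = ?A"
    unfolding mat_adjoint_def using assms(1)
    by (intro eq_matI) (auto simp: mat_of_rows_def conjugate_complex_def)
  moreover have "(?A *\<^sub>v v) \<bullet>c v = (\<Sum>i<n. \<Sum>j<n. of_real (f i j) * v $ j * cnj (v $ i))"
    if "v \<in> carrier_vec n" for v
    by (subst scalar_prod_quad_form[of _ n]) (use that in \<open>auto simp: quad_form_def intro!: sum.cong\<close>)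
  ultimately show ?thesis using assms(2) by (simp add: pos_def_hermitian_def)
qed

lemma nonzero_vec_entry:
  "v \<in> carrier_vec n \<Longrightarrow> v \<noteq> 0\<^sub>v n \<Longrightarrow> \<exists>i<n. v $ i \<noteq> 0"
  by (metis carrier_vecD eq_vecI index_zero_vec)

lemma diagonal_pos_def:
  assumes c: "\<And>r. c r > 0"
  shows "pos_def_hermitian n (diagonal_mat_of n c)"
  unfolding diagonal_mat_of_def
proof (rule real_pos_def_hermitian)
  fix v :: "complex vec" assume v: "v \<in> carrier_vec n" "v \<noteq> 0\<^sub>v n"
  have "(\<Sum>i<n. \<Sum>j<n. of_real (if i = j then c i else 0) * v $ j * cnj (v $ i)) =
      (\<Sum>i<n. of_real (c i * (cmod (v $ i))\<^sup>2))"
  proof (rule sum.cong[OF refl])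
    fix i assume i: "i \<in> {..<n}"
    have "(\<Sum>j<n. of_real (if i = j then c i else 0) * v $ j * cnj (v $ i)) =
        (\<Sum>j<n. if i = j then of_real (c i) * (v $ j * cnj (v $ i)) else 0)"
      by (intro sum.cong) auto
    also have "\<dots> = of_real (c i * (cmod (v $ i))\<^sup>2)"
      using i by (simp only: sum.delta finite_lessThan of_real_mult complex_norm_square) simp
    finally show "(\<Sum>j<n. of_real (if i = j then c i else 0) * v $ j * cnj (v $ i)) = of_real (c i * (cmod (v $ i))\<^sup>2)" .
  qed
  moreover obtain i where "i < n" "v $ i \<noteq> 0" using nonzero_vec_entry[OF v] by blast
  then have "0 < (\<Sum>i<n. c i * (cmod (v $ i))\<^sup>2)"
    using c by (intro sum_pos2[of _ i]) (auto intro!: mult_nonneg_nonneg less_imp_le[OF c])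
  ultimately show "0 < Re (\<Sum>i<n. \<Sum>j<n. of_real (if i = j then c i else 0) * v $ j * cnj (v $ i))"
    by (simp only: of_real_sum[symmetric] Re_complex_of_real)
qed auto

text \<open>
  The matrix \<open>A\<close> is invertible since its determinant is a leading minor.
\<close>

lemma gram_pos_def: "pos_def_hermitian n (gram_mat n H)"
  unfolding gram_mat_def
proof (rule real_pos_def_hermitian)
  let ?a = "net n (weight H) 0" and ?\<mu> = "exp (H 0 n / n)"
  show "?\<mu> * (\<Sum>u<n. ?a i u * ?a j u) = ?\<mu> * (\<Sum>u<n. ?a j u * ?a i u)" for i j
    by (simp add: mult.commute)
  fix v :: "complex vec" assume v: "v \<in> carrier_vec n" "v \<noteq> 0\<^sub>v n"
  define w where "w u = (\<Sum>j<n. of_real (?a j u) * v $ j)" for u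
  have "(\<Sum>i<n. \<Sum>j<n. of_real (?\<mu> * (\<Sum>u<n. ?a i u * ?a j u)) * v $ j * cnj (v $ i)) =
      (\<Sum>i<n. \<Sum>j<n. \<Sum>u<n. of_real ?\<mu> * ((of_real (?a j u) * v $ j) * cnj (of_real (?a i u) * v $ i)))"
    by (simp add: sum_distrib_left sum_distrib_right mult_ac)
  also have "\<dots> = (\<Sum>i<n. \<Sum>u<n. \<Sum>j<n. of_real ?\<mu> * ((of_real (?a j u) * v $ j) * cnj (of_real (?a i u) * v $ i)))"
    by (rule sum.cong[OF refl], rule sum.swap)
  also have "\<dots> = (\<Sum>u<n. \<Sum>i<n. \<Sum>j<n. of_real ?\<mu> * ((of_real (?a j u) * v $ j) * cnj (of_real (?a i u) * v $ i)))"
    by (rule sum.swap)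
  also have "\<dots> = (\<Sum>u<n. \<Sum>j<n. \<Sum>i<n. of_real ?\<mu> * ((of_real (?a j u) * v $ j) * cnj (of_real (?a i u) * v $ i)))"
    by (rule sum.cong[OF refl], rule sum.swap)
  also have "\<dots> = (\<Sum>u<n. of_real ?\<mu> * (w u * cnj (w u)))"
    by (simp only: w_def cnj_sum sum_product) (simp only: sum_distrib_left)
  also have "\<dots> = of_real (?\<mu> * (\<Sum>u<n. (cmod (w u))\<^sup>2))"
    by (simp only: of_real_mult of_real_sum complex_norm_square sum_distrib_left)
  finally have eq: "(\<Sum>i<n. \<Sum>j<n. of_real (?\<mu> * (\<Sum>u<n. ?a i u * ?a j u)) * v $ j * cnj (v $ i)) =
    of_real (?\<mu> * (\<Sum>u<n. (cmod (w u))\<^sup>2))" .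
  have "\<exists>u<n. w u \<noteq> 0"
  proof (rule ccontr)
    assume "\<not> (\<exists>u<n. w u \<noteq> 0)"
    then have w0: "w u = 0" if "u < n" for u using that by blast
    let ?B = "mat n n (\<lambda>(u, j). complex_of_real (?a j u))"
    have "?B *\<^sub>v v = 0\<^sub>v n"
      using v(1) w0 by (intro eq_vecI) (auto simp: w_def mult_mat_vec_def scalar_prod_def atLeast0LessThan)
    then have "det ?B = 0" using v det_0_iff_vec_prod_zero_field[of ?B n] by auto
    then have "det (mat n n (\<lambda>(u, j). ?a j u)) = 0" unfolding det_mat_of_real by simp
    then have "net_minor n (weight H) 0 n (\<lambda>r. 0 + r) (\<lambda>q. 0 + q) = 0"
      unfolding net_minor_def using det_mat_transpose[of n ?a] by simp
    moreover have "\<bar>net_minor n (weight H) 0 n (\<lambda>r. 0 + r) (\<lambda>q. 0 + q)\<bar> = (\<Prod>q<n. weight H (0 + q) (0 + n - Suc q))"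
      by (rule net_minor_leading) (auto simp: weight_def)
    moreover have "(\<Prod>q<n. weight H (0 + q) (0 + n - Suc q)) > 0"
      by (intro prod_pos) (auto simp: weight_def)
    ultimately show False by linarith
  qed
  then obtain u where "u < n" "w u \<noteq> 0" by blast
  then have "0 < (\<Sum>u<n. (cmod (w u))\<^sup>2)" by (intro sum_pos2[of _ u]) auto
  then show "0 < Re (\<Sum>i<n. \<Sum>j<n. of_real (?\<mu> * (\<Sum>u<n. ?a i u * ?a j u)) * v $ j * cnj (v $ i))"
    unfolding eq by simp
qed

lemma net_coeff_realised:
  assumes n: "n \<ge> 1"
  shows "\<exists>F\<in>detH n. \<forall>d. Poly_Mapping.lookup F d = net_coeff n H d"
proof -
  let ?X = "gram_mat n H" and ?Y = "diagonal_mat_of n (\<lambda>_. exp (H 0 n / n))"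
    and ?Z = "diagonal_mat_of n (\<lambda>r. exp (H 0 n / n - slope H 0 r))"
  let ?P = "det (pencil ?X ?Y ?Z)"
  have carrier: "?X \<in> carrier_mat n n" "?Y \<in> carrier_mat n n" "?Z \<in> carrier_mat n n"
    by (simp_all add: gram_mat_def diagonal_mat_of_def)
  have look: "Poly_Mapping.lookup ?P d = of_real (net_coeff n H d)" for d
    unfolding lookup_det_pencil[OF carrier] net_coeff_def using mixed_det_net[OF n] by simp
  define F where "F = Poly_Mapping.map Re ?P"
  have F: "Poly_Mapping.lookup F d = net_coeff n H d" for d
    unfolding F_def by (simp add: Poly_Mapping.map.rep_eq look when_def)
  have "Poly_Mapping.map complex_of_real F = ?P"
    by (rule poly_mapping_eqI) (simp add: Poly_Mapping.map.rep_eq look F when_def)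
  moreover have "homogeneous3 n F"
    unfolding homogeneous3_def
  proof
    fix d assume "d \<in> Poly_Mapping.keys F"
    then have "net_coeff n H d \<noteq> 0" by (simp add: in_keys_iff F)
    then have "\<exists>\<phi>. \<phi> \<in> words n \<and> word_content n \<phi> = d"
      unfolding net_coeff_def by (metis (mono_tags, lifting) Collect_empty_eq sum.empty)
    then show "d \<in> Delta n" using word_content_in_Delta by blast
  qed
  ultimately have "F \<in> detH n"
    unfolding detH_def using gram_pos_def diagonal_pos_def by (intro CollectI conjI exI[of _ ?X] exI[of _ ?Y] exI[of _ ?Z]) auto
  then show ?thesis using F by blast
qed

section \<open>The coefficients follow the hive up to a constant\<close>

lemma word_term_nonneg: "word_term n H \<phi> \<ge> 0"
  unfolding word_term_def Let_def by (intro mult_nonneg_nonneg sum_nonneg divide_nonneg_nonneg) auto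

lemma net_coeff_lower:
  assumes d: "(i, j, k) \<in> Delta n"
  shows "exp (H i j) / fact n \<le> net_coeff n H (i, j, k)"
proof -
  have n: "i + j + k = n" using d by (simp add: Delta_def)
  (* The word y^j x^i z^k; together with the first i columns it gives the dominant term. *)
  define \<phi> where "\<phi> = (\<lambda>r\<in>{..<n}. if r < j then 1 else if r < j + i then 0 else 2 :: nat)"
  have \<phi>: "\<phi> \<in> words n" by (auto simp: words_def \<phi>_def)
  have l0: "letter n \<phi> 0 = {j..<j + i}" and l1: "letter n \<phi> 1 = {..<j}" and l2: "letter n \<phi> 2 = {j + i..<n}"
    using n by (auto simp: letter_def \<phi>_def split: if_splits)
  have content: "word_content n \<phi> = (i, j, k)"
    using word_content_eq[OF \<phi>] l0 l1 l2 n unfolding letter_def by simp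
  have place: "place n \<phi> r = j + r" if "r < i" for r
    using that by (simp add: place_def l0)
  let ?f = "\<lambda>q\<in>{..<i}. q"
  have f: "?f \<in> (\<Pi>\<^sub>E i\<in>{..<i}. {..<n})" using n by auto
  have "net_minor n (weight H) 0 i (place n \<phi>) ?f = net_minor n (weight H) 0 i (\<lambda>r. j + r) (\<lambda>q. q)"
    by (rule net_minor_cong) (auto simp: place)
  then have "(net_minor n (weight H) 0 i (place n \<phi>) ?f)\<^sup>2 = exp (H i j - H 0 (i + j))"
    using net_minor_leading_weight[of i j n H] n by simp
  then have "exp (H i j - H 0 (i + j)) \<le> (\<Sum>f\<in>(\<Pi>\<^sub>E i\<in>{..<i}. {..<n}). (net_minor n (weight H) 0 i (place n \<phi>) f)\<^sup>2)"
    using member_le_sum[OF f, of "\<lambda>f. (net_minor n (weight H) 0 i (place n \<phi>) f)\<^sup>2"]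
    by (simp add: finite_PiE)
  moreover have "{..<n} - letter n \<phi> 2 = {..<i + j}" using n by (auto simp: l2)
  then have "H 0 0 + (\<Sum>r\<in>{..<n} - letter n \<phi> 2. slope H 0 r) = H 0 (i + j)"
    by (simp only: sum_slope)
  ultimately have "exp (H 0 (i + j)) / fact i * exp (H i j - H 0 (i + j)) \<le> word_term n H \<phi>"
    by (auto simp: word_term_def l0 intro!: divide_right_mono mult_left_mono)
  moreover have "exp (H 0 (i + j)) / fact i * exp (H i j - H 0 (i + j)) = exp (H i j) / fact i"
    by (simp add: exp_diff)
  moreover have "exp (H i j) / fact n \<le> exp (H i j) / fact i"
    using n by (intro divide_left_mono fact_mono) auto
  moreover have "word_term n H \<phi> \<le> net_coeff n H (i, j, k)"
    unfolding net_coeff_def using \<phi> content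
    by (intro member_le_sum) (auto simp: word_term_nonneg)
  ultimately show ?thesis by linarith
qed

text \<open>
  For each word the bound on minors applies with \<open>T\<close> the set of rows with a letter other than \<open>z\<close>.
  The numbers of words and of column choices depend on \<open>n\<close> only.
\<close>

lemma net_coeff_upper:
  assumes n: "n \<ge> 1"
  shows "\<exists>C>0. \<forall>H i j k. rhombus_concave n H \<longrightarrow> (i, j, k) \<in> Delta n \<longrightarrow> net_coeff n H (i, j, k) \<le> C * exp (H i j)"
proof -
  from choice[OF allI[OF net_minor_upper[OF n]]] obtain K where K: "\<forall>m. K m > 0 \<and>
    (\<forall>H t s f T j. rhombus_concave n H \<longrightarrow> (\<forall>r. Suc r < m \<longrightarrow> s r < s (Suc r)) \<longrightarrow>
    T \<subseteq> {..<n - t} \<longrightarrow> s ` {..<m} \<subseteq> T \<longrightarrow> card T = m + j \<longrightarrow> (\<forall>q<m. f q < n) \<longrightarrow>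
    exp ((\<Sum>u\<in>T. slope H t u) / 2) * \<bar>net_minor n (weight H) t m s f\<bar>
      \<le> K m * exp ((H (t + m) j - H t 0) / 2))" ..
  note K_pos = K[THEN spec, THEN conjunct1] and K_bound = K[THEN spec, THEN conjunct2, rule_format]
  define L where "L = (\<Sum>m\<le>n. (K m)\<^sup>2)"
  have L: "(K m)\<^sup>2 \<le> L" if "m \<le> n" for m
    unfolding L_def using that by (intro member_le_sum) auto
  have L0: "L > 0" using L[OF le0] zero_less_power[OF K_pos, of 0 2] by linarith
  have word: "word_term n H \<phi> \<le> real (n ^ i) * (L * exp (H i j))"
    if H: "rhombus_concave n H" and \<phi>: "\<phi> \<in> words n" and content: "word_content n \<phi> = (i, j, k)" for H \<phi> i j k
  proof -
    note card = word_content_letter[OF \<phi> content]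
    let ?T = "{..<n} - letter n \<phi> 2"
    let ?E = "exp (\<Sum>r\<in>?T. slope H 0 r)"
    have i: "i \<le> n" using word_content_in_Delta[OF \<phi>] content by (simp add: Delta_def)
    have one: "?E * (net_minor n (weight H) 0 i (place n \<phi>) f)\<^sup>2 \<le> L * exp (H i j - H 0 0)"
      if f: "f \<in> (\<Pi>\<^sub>E i\<in>{..<i}. {..<n})" for f
    proof -
      have "exp ((\<Sum>r\<in>?T. slope H 0 r) / 2) * \<bar>net_minor n (weight H) 0 i (place n \<phi>) f\<bar>
        \<le> K i * exp ((H (0 + i) j - H 0 0) / 2)"
      proof (rule K_bound[OF H])
        show "place n \<phi> r < place n \<phi> (Suc r)" if "Suc r < i" for r
          using that card(1) by (intro place_less) auto
        have "place n \<phi> ` {..<i} = letter n \<phi> 0"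
          using bij_betw_place[of n \<phi>] card(1) by (simp add: bij_betw_def)
        then show "place n \<phi> ` {..<i} \<subseteq> ?T" by (auto simp: letter_def)
        show "f q < n" if "q < i" for q using f that by auto
      qed (use card in auto)
      then have "(exp ((\<Sum>r\<in>?T. slope H 0 r) / 2) * \<bar>net_minor n (weight H) 0 i (place n \<phi>) f\<bar>)\<^sup>2
        \<le> (K i * exp ((H i j - H 0 0) / 2))\<^sup>2"
        by (intro power_mono) auto
      also have "\<dots> = (K i)\<^sup>2 * exp (H i j - H 0 0)"
        by (simp add: power_mult_distrib exp_double[symmetric])
      also have "\<dots> \<le> L * exp (H i j - H 0 0)"
        using L[OF i] by (intro mult_right_mono) auto
      finally show ?thesis
        by (simp add: power_mult_distrib exp_double[symmetric])
    qed
    let ?F = "\<Pi>\<^sub>E i\<in>{..<i}. {..<n}"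
    have "word_term n H \<phi> = exp (H 0 0) / fact i * (\<Sum>f\<in>?F. ?E * (net_minor n (weight H) 0 i (place n \<phi>) f)\<^sup>2)"
      unfolding word_term_def Let_def card(1) exp_add sum_distrib_left by (simp add: mult_ac)
    also have "\<dots> \<le> exp (H 0 0) / fact i * (\<Sum>f\<in>?F. L * exp (H i j - H 0 0))"
      by (intro mult_left_mono sum_mono one) auto
    also have "\<dots> \<le> exp (H 0 0) / 1 * (\<Sum>f\<in>?F. L * exp (H i j - H 0 0))"
      using L0 by (intro mult_right_mono divide_left_mono) (auto intro!: sum_nonneg)
    also have "\<dots> = real (n ^ i) * (L * exp (H i j))"
      by (simp add: card_PiE exp_diff)
    finally show ?thesis .
  qed
  let ?C = "real (card (words n)) * (real (n ^ n) * L)"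
  have "words n \<noteq> {}" unfolding words_def by (auto simp: PiE_eq_empty_iff lessThan_empty_iff)
  then have "?C > 0" using n L0 by (simp add: card_gt_0_iff)
  moreover have "net_coeff n H (i, j, k) \<le> ?C * exp (H i j)"
    if H: "rhombus_concave n H" and d: "(i, j, k) \<in> Delta n" for H i j k
  proof -
    let ?W = "{\<phi>. \<phi> \<in> words n \<and> word_content n \<phi> = (i, j, k)}"
    have i: "i \<le> n" using d by (simp add: Delta_def)
    have "net_coeff n H (i, j, k) \<le> (\<Sum>\<phi>\<in>?W. real (n ^ i) * (L * exp (H i j)))"
      unfolding net_coeff_def by (intro sum_mono word[OF H]) auto
    also have "\<dots> = real (card ?W) * (real (n ^ i) * (L * exp (H i j)))" by simp
    also have "\<dots> \<le> real (card (words n)) * (real (n ^ n) * (L * exp (H i j)))"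
    proof (intro mult_mono)
      show "real (card ?W) \<le> real (card (words n))" by (intro of_nat_mono card_mono) auto
      show "real (n ^ i) \<le> real (n ^ n)" using i n by (intro of_nat_mono power_increasing) auto
    qed (use L0 in auto)
    finally show ?thesis by (simp add: mult_ac)
  qed
  ultimately show ?thesis by blast
qed

lemma net_coeff_log_bound:
  assumes n: "n \<ge> 1"
  shows "\<exists>C>0. \<forall>H i j k. rhombus_concave n H \<longrightarrow> (i, j, k) \<in> Delta n \<longrightarrow> \<bar>ln (net_coeff n H (i, j, k)) - H i j\<bar> \<le> C"
proof -
  obtain B where B: "B > 0" "\<And>H i j k. rhombus_concave n H \<Longrightarrow> (i, j, k) \<in> Delta n \<Longrightarrow> net_coeff n H (i, j, k) \<le> B * exp (H i j)"
    using net_coeff_upper[OF n] by blast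
  have "\<bar>ln (net_coeff n H (i, j, k)) - H i j\<bar> \<le> \<bar>ln B\<bar> + ln (fact n) + 1"
    if H: "rhombus_concave n H" and d: "(i, j, k) \<in> Delta n" for H i j k
  proof -
    have low: "exp (H i j) / fact n \<le> net_coeff n H (i, j, k)" by (rule net_coeff_lower[OF d])
    have pos: "0 < exp (H i j) / fact n" by simp
    then have cpos: "0 < net_coeff n H (i, j, k)" using low by linarith
    have "ln (exp (H i j) / fact n) \<le> ln (net_coeff n H (i, j, k))"
      using low pos cpos by (subst ln_le_cancel_iff) auto
    moreover have "ln (exp (H i j) / fact n) = H i j - ln (fact n)" by (simp add: ln_div)
    moreover have "ln (net_coeff n H (i, j, k)) \<le> ln (B * exp (H i j))"
      using B(2)[OF H d] cpos B(1) by (subst ln_le_cancel_iff) auto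
    moreover have "ln (B * exp (H i j)) = ln B + H i j" using B(1) by (simp add: ln_mult)
    moreover have "(0 :: real) \<le> ln (fact n)" by (intro ln_ge_zero fact_ge_1)
    ultimately show ?thesis by linarith
  qed
  moreover have "0 < \<bar>ln B\<bar> + ln (fact n) + 1"
  proof -
    have "(0 :: real) \<le> ln (fact n)" by (intro ln_ge_zero fact_ge_1)
    then show ?thesis by linarith
  qed
  ultimately show ?thesis by blast
qed

section \<open>Continuous dependence on the hive\<close>

lemma continuous_on_net:
  assumes "\<And>t s. continuous_on A (\<lambda>x. c x t s)" "\<And>x t s. c x t s > 0"
  shows "continuous_on A (\<lambda>x. net n (c x) t s u)"
proof (induction "u - t" arbitrary: t s)
  case 0
  then show ?case using assms(1) by (cases "u = t") auto
next
  case (Suc k)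
  then have u: "t < u" by auto
  have "continuous_on A (\<lambda>x. net n (c x) (Suc t) l u)" for l
    using Suc.hyps(1)[of "Suc t" l] Suc.hyps(2) by simp
  moreover have "c x t s \<noteq> 0" for x t s using assms(2)[of x t s] by simp
  ultimately show ?case using assms(1) unfolding net_above[OF u]
    by (intro continuous_intros) auto
qed

lemma continuous_on_det_mat:
  fixes f :: "'x::topological_space \<Rightarrow> nat \<Rightarrow> nat \<Rightarrow> real"
  assumes "\<And>i j. continuous_on A (\<lambda>x. f x i j)"
  shows "continuous_on A (\<lambda>x. det (mat m m (\<lambda>(i, j). f x i j)))"
  unfolding det_mat_permutations using assms by (intro continuous_intros) auto

lemma continuous_on_net_coeff:
  assumes H: "\<And>t s. continuous_on A (\<lambda>x. H x t s)"
  shows "continuous_on A (\<lambda>x. net_coeff n (H x) d)"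
proof -
  have w: "continuous_on A (\<lambda>x. weight (H x) t s)" for t s
    unfolding weight_def drift_def using H by (intro continuous_intros) auto
  have m: "continuous_on A (\<lambda>x. net_minor n (weight (H x)) t m s f)" for t m s f
    unfolding net_minor_def
    by (intro continuous_on_det_mat continuous_on_net w) (simp add: weight_def)
  show ?thesis
    unfolding net_coeff_def word_term_def Let_def slope_def using H m
    by (intro continuous_intros) auto
qed

section \<open>Both inclusions\<close>

text \<open>
  Four perturbations by at most \<open>C\<close> change a rhombus expression by at most \<open>4 C\<close>, which is what the
  term \<open>- 2 C (i\<^sup>2 + j\<^sup>2 + k\<^sup>2)\<close> adds to it.
\<close>

lemma near_deep_hive_concave:
  assumes h: "h \<in> HIVE n" and g: "\<And>d. d \<in> Delta n \<Longrightarrow> \<bar>g d - (h d - 2 * C * sq3 d)\<bar> \<le> C"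
  shows "rhombus_concave n (\<lambda>t u. g (t, u, n - t - u))"
  unfolding rhombus_concave_def
proof (intro allI impI)
  fix t u assume "t + u + 2 \<le> n"
  then obtain k where n: "n = t + u + k + 2" by (metis add.commute add.left_commute le_Suc_ex)
  have hive: "(i, j, k) \<in> Delta n \<Longrightarrow>
     (2 \<le> k \<longrightarrow> h (i + 1, j, k - 1) + h (i, j + 1, k - 1) \<ge> h (i, j, k) + h (i + 1, j + 1, k - 2)) \<and>
     (2 \<le> j \<longrightarrow> h (i + 1, j - 1, k) + h (i, j - 1, k + 1) \<ge> h (i, j, k) + h (i + 1, j - 2, k + 1)) \<and>
     (2 \<le> i \<longrightarrow> h (i - 1, j + 1, k) + h (i - 1, j, k + 1) \<ge> h (i, j, k) + h (i - 2, j + 1, k + 1))" for i j k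
    using h unfolding HIVE_def by blast
  have b: "g (i, j, k) \<le> h (i, j, k) - 2 * C * sq3 (i, j, k) + C"
    "h (i, j, k) - 2 * C * sq3 (i, j, k) - C \<le> g (i, j, k)" if "i + j + k = n" for i j k
    using g[of "(i, j, k)"] that by (auto simp: Delta_def abs_le_iff)
  have D: "(t, u, k + 2) \<in> Delta n" "(t, u + 2, k) \<in> Delta n" "(t + 2, u, k) \<in> Delta n"
    using n by (auto simp: Delta_def)
  note hs = hive[OF D(1)] hive[OF D(2)] hive[OF D(3)]
  note bs = b[of t u "k + 2"] b[of "t + 1" "u + 1" k] b[of "t + 1" u "k + 1"] b[of t "u + 1" "k + 1"]
    b[of t "u + 2" k] b[of "t + 2" u k]
  have sq: "C * sq3 (t, u, k + 2) + C * sq3 (t + 1, u + 1, k) = 2 * C + (C * sq3 (t + 1, u, k + 1) + C * sq3 (t, u + 1, k + 1))"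
    "C * sq3 (t, u + 2, k) + C * sq3 (t + 1, u, k + 1) = 2 * C + (C * sq3 (t + 1, u + 1, k) + C * sq3 (t, u + 1, k + 1))"
    "C * sq3 (t + 2, u, k) + C * sq3 (t, u + 1, k + 1) = 2 * C + (C * sq3 (t + 1, u + 1, k) + C * sq3 (t + 1, u, k + 1))"
    by (simp_all add: sq3_def power2_eq_square algebra_simps)
  have "g (t, u, k + 2) + g (t + 1, u + 1, k) \<le> g (t + 1, u, k + 1) + g (t, u + 1, k + 1)"
    using bs sq(1) hs(1) n by simp
  moreover have "g (t, u + 2, k) + g (t + 1, u, k + 1) \<le> g (t + 1, u + 1, k) + g (t, u + 1, k + 1)"
    using bs sq(2) hs(2) n by simp
  moreover have "g (t + 2, u, k) + g (t, u + 1, k + 1) \<le> g (t + 1, u + 1, k) + g (t + 1, u, k + 1)"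
    using bs sq(3) hs(3) n by simp
  ultimately show "g (t, u, n - t - u) + g (Suc t, Suc u, n - Suc t - Suc u)
      \<le> g (Suc t, u, n - Suc t - u) + g (t, Suc u, n - t - Suc u) \<and>
    g (t, Suc (Suc u), n - t - Suc (Suc u)) + g (Suc t, u, n - Suc t - u)
      \<le> g (Suc t, Suc u, n - Suc t - Suc u) + g (t, Suc u, n - t - Suc u) \<and>
    g (Suc (Suc t), u, n - Suc (Suc t) - u) + g (t, Suc u, n - t - Suc u)
      \<le> g (Suc t, Suc u, n - Suc t - Suc u) + g (Suc t, u, n - Suc t - u)"
    by (simp add: n)
qed

lemma deep_hives_realised:
  assumes n: "n \<ge> 1"
  shows "\<exists>V\<in>RDelta n. translate V (HIVE n) \<subseteq> log_coeffs n ` detH n"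
proof -
  obtain C where C: "C > 0" and bound: "\<And>H i j k. rhombus_concave n H \<Longrightarrow> (i, j, k) \<in> Delta n \<Longrightarrow>
      \<bar>ln (net_coeff n H (i, j, k)) - H i j\<bar> \<le> C"
    using net_coeff_log_bound[OF n] by blast
  define V where "V d = (if d \<in> Delta n then - 2 * C * sq3 d else 0)" for d
  have "(\<lambda>d. V d + h d) \<in> log_coeffs n ` detH n" if h: "h \<in> HIVE n" for h
  proof -
    obtain \<beta> where \<beta>: "bij_betw \<beta> {..<card (Delta n)} (Delta n)"
      using ex_bij_betw_nat_finite[OF finite_Delta, of n] by (auto simp: atLeast0LessThan)
    define \<iota> where "\<iota> = inv_into {..<card (Delta n)} \<beta>"
    (* The cube parametrises the functions at distance at most C from the target V + h. A fixed
       point of f is a g whose deviation from the target is the negative of the error of the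
       coefficients. *)
    define g where "g x d = V d + h d + C * (2 * x (\<iota> d) - 1)" for x :: "nat \<Rightarrow> real" and d
    define H where "H x t u = g x (t, u, n - t - u)" for x t u
    define f where "f x i = (C - (ln (net_coeff n (H x) (\<beta> i)) - g x (\<beta> i))) / (2 * C)" for x i
    have gcont: "continuous_on UNIV (\<lambda>x. g x d)" for d
      unfolding g_def by (intro continuous_intros) (simp_all add: continuous_on_product_coordinates)
    have \<beta>D: "\<beta> i \<in> Delta n" if "i < card (Delta n)" for i
      using \<beta> that by (auto simp: bij_betw_def)
    have cpos: "net_coeff n (H x) d > 0" if d: "d \<in> Delta n" for x d
    proof -
      obtain i j k where "d = (i, j, k)" by (cases d) auto
      moreover have "0 < exp (H x i j) / fact n" by simp
      ultimately show ?thesis using net_coeff_lower[of i j k n "H x"] d by (smt (verit))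
    qed
    have close: "\<bar>ln (net_coeff n (H x) d) - g x d\<bar> \<le> C"
      if x: "\<And>i. 0 \<le> x i \<and> x i \<le> 1" and d: "d \<in> Delta n" for x d
    proof -
      have "\<bar>g x d - (h d - 2 * C * sq3 d)\<bar> \<le> C" if "d \<in> Delta n" for d
      proof -
        have "\<bar>2 * x (\<iota> d) - 1\<bar> \<le> 1" using x[of "\<iota> d"] by (simp add: abs_le_iff)
        then have "\<bar>C * (2 * x (\<iota> d) - 1)\<bar> \<le> C" using C by (simp add: abs_mult)
        then show ?thesis using that by (simp add: g_def V_def)
      qed
      then have conc: "rhombus_concave n (H x)"
        unfolding H_def by (rule near_deep_hive_concave[OF h])
      obtain i j k where dd: "d = (i, j, k)" by (cases d) auto
      then have "n - i - j = k" using d by (auto simp: Delta_def)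
      then have "H x i j = g x d" by (simp add: H_def dd)
      then show ?thesis using bound[OF conc, of i j k] d dd by simp
    qed
    obtain x where x: "\<And>i. 0 \<le> x i \<and> x i \<le> 1" and fx: "\<And>i. i < card (Delta n) \<Longrightarrow> f x i = x i"
    proof -
      have "continuous_on UNIV (\<lambda>x. f x i)" if "i < card (Delta n)" for i
      proof -
        have "continuous_on UNIV (\<lambda>x. net_coeff n (H x) (\<beta> i))"
          unfolding H_def by (intro continuous_on_net_coeff gcont)
        moreover have "net_coeff n (H x) (\<beta> i) \<noteq> 0" for x
          using cpos[OF \<beta>D[OF that], of x] by simp
        ultimately show ?thesis unfolding f_def using gcont C by (intro continuous_intros) auto
      qed
      moreover have "0 \<le> f x i \<and> f x i \<le> 1" if "\<And>j. 0 \<le> x j \<and> x j \<le> 1" "i < card (Delta n)" for x i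
        using close[OF that(1) \<beta>D[OF that(2)]] C by (simp add: f_def abs_le_iff field_simps)
      ultimately show ?thesis using brouwer_cube[of "card (Delta n)" f] that by blast
    qed
    obtain F where F: "F \<in> detH n" "\<And>d. Poly_Mapping.lookup F d = net_coeff n (H x) d"
      using net_coeff_realised[OF n] by blast
    have "log_coeffs n F d = V d + h d" for d
    proof (cases "d \<in> Delta n")
      case True
      have \<iota>: "\<iota> d < card (Delta n)" "\<beta> (\<iota> d) = d"
        using bij_betw_inv_into[OF \<beta>] bij_betw_inv_into_right[OF \<beta> True] True
        unfolding \<iota>_def by (auto simp: bij_betw_def)
      have "C - (ln (net_coeff n (H x) d) - g x d) = 2 * C * x (\<iota> d)"
        using fx[OF \<iota>(1)] \<iota>(2) C by (simp add: f_def field_simps)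
      then have "ln (net_coeff n (H x) d) = V d + h d" by (simp add: g_def algebra_simps)
      then show ?thesis using True by (simp add: log_coeffs_def F)
    next
      case False
      moreover have "h \<in> RDelta n" using h unfolding HIVE_def by blast
      ultimately show ?thesis by (cases d) (simp add: log_coeffs_def V_def RDelta_def)
    qed
    then have "(\<lambda>d. V d + h d) = log_coeffs n F" by (simp add: fun_eq_iff)
    then show ?thesis using F(1) by blast
  qed
  then have "translate V (HIVE n) \<subseteq> log_coeffs n ` detH n" by (auto simp: translate_def)
  moreover have "V \<in> RDelta n" by (simp add: RDelta_def V_def)
  ultimately show ?thesis by blast
qed

theorem theorem13:
  fixes n :: nat
  assumes "n \<ge> 1"
  shows "\<exists>V1 \<in> RDelta n. \<exists>V2 \<in> RDelta n.
           translate V1 (HIVE n) \<supseteq> log_coeffs n ` detH n \<and>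
           log_coeffs n ` detH n \<supseteq> translate V2 (HIVE n)"
proof -
  have "outer_apex n \<in> RDelta n" by (simp add: RDelta_def outer_apex_def)
  moreover have "log_coeffs n ` detH n \<subseteq> translate (outer_apex n) (HIVE n)"
    using log_coeffs_in_hives by blast
  ultimately show ?thesis using deep_hives_realised[OF assms] by blast
qed

end
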